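(* Let $K\subseteq[0,\infty)$ be nonempty and finite, let $R>0$, $r>1$, $\theta>\pi/2$, let $\Delta\subseteq[0,\infty)$ be natural and closed under addition, and set $\tau=(K,R,r,\theta,\Delta)$. Then the map $T:\mathcal{G}_\tau\to\mathbb{C}[[X^*]]$, sending a generalized multisummable function $f\in\mathcal{G}_\tau$ to its asymptotic expansion $Tf$, is injective.
   Context: $\overline{\mathbb{C}}=\mathbb{C}\cup\{-\infty\}$, where $\mathbb{C}$ is open with its usual topology and the sets $H(\mathfrak r)=\{w\in\overline{\mathbb{C}}:\operatorname{Re}w<\mathfrak r\}$ (containing $-\infty$, $\operatorname{Re}(-\infty)=-\infty$, $e^{-\infty}=0$) are the basic open neighbourhoods of $-\infty$. For $\varphi>0$, $S(0,\mathfrak r,\varphi)=\{u+iv\in\mathbb{C}:u<\mathfrak r,|v|<\varphi\}\cup\{-\infty\}$. A log-domain is a set $D\subseteq\overline{\mathbb{C}}$ with $D\cap\mathbb{C}$ a domain; a log-holomorphic function on $D$ is a continuous $f:D\to\mathbb{C}$ that is holomorphic on $D\cap\mathbb{C}$. A set $\Delta\subseteq\mathbb{R}$ is natural if $\Delta\cap(-\infty,a)$ is finite for all $a\in\mathbb{R}$. $\mathbb{C}[[X^*]]$ (one indeterminate) is the ring of generalized power series $F=\sum_{\alpha\ge0}a_\alpha X^\alpha$ with $a_\alpha\in\mathbb{C}$ and well-ordered support in $[0,\infty)$; $\|F\|_s=\sum|a_\alpha|s^\alpha$ for $s>0$; $\mathbb{C}\{X^*\}$ is the set of those with $\|F\|_s<\infty$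 for some $s>0$; if $\|F\|_s<\infty$, the log-sum of $F$ is $\overline F(w)=\sum a_\alpha e^{\alpha w}$ on $H(\log s)$. For $k\ge0$, $p\in\mathbb{N}$: $\rho^{R,k}_p=R/(1+p)^k$, and $S^{R,k}_p=\mathrm{cl}\big(S(0,\log R,\theta k)\cup H(\log\rho^{R,k}_p)\big)$ (for $k=0$ this is $\mathrm{cl}(H(\log R))$). Put $S^\tau=\bigcap_{k\in K\setminus\{0\}}S(0,\log R,\theta k)$ if $K\ne\{0\}$, $S^\tau=H(\log R)$ if $K=\{0\}$; $\rho^\tau_p=\min_{k\in K}\rho^{R,k}_p$; $S^\tau_p=\bigcap_{k\in K}S^{R,k}_p$. For $f:S^\tau\to\mathbb{C}$ log-holomorphic, write $f=_\tau\sum_pf_p$ if for every $p\in\mathbb{N}$: $f_p:S^\tau_p\to\mathbb{C}$ is the restriction of a log-holomorphic function on a log-domain containing $S^\tau_p$; there is $F_p=\sum_\alpha a_{p,\alpha}X^\alpha\in\mathbb{C}\{X^*\}$ with support in $\Delta$, $\|F_p\|_{\rho^\tau_p}<\infty$ and $f_p=\overline{F_p}$ on $H(\log\rho^\tau_p)$; and $\sum_p\|F_p\|_{\rho^\tau_p}r^p<\infty$, $\sum_p\sup_{S^\tau_p}|f_p|\,r^p<\infty$, and $f=\sum_pf_p$ on $S^\tau$. $\mathcal{G}_\tau$ is the set of all log-holomorphic $f:S^\tau\to\mathbb{C}$ admitting such a sequence. For $f\in\mathcal{G}_\tau$, $Tf=\sum_\alpha a_\alpha X^\alpha$ with $a_\alpha=\sum_pa_{p,\alpha}$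 (absolutely convergent); this series depends only on $f$, since $\sum a_\alpha e^{\alpha w}$ is an asymptotic expansion of $f$ at $-\infty$. *)

theory Defs
  imports "HOL-Complex_Analysis.Complex_Analysis"
begin

section \<open>The logarithmic plane: the complex numbers with a point at minus infinity\<close>

datatype logplane = Fin complex | MInf

definition half_plane :: "real \<Rightarrow> logplane set" where
  "half_plane x = insert MInf (Fin ` {z. Re z < x})"

definition strip :: "real \<Rightarrow> real \<Rightarrow> logplane set" where
  "strip x \<phi> = insert MInf (Fin ` {z. Re z < x \<and> \<bar>Im z\<bar> < \<phi>})"

instantiation logplane :: topological_space
begin

definition open_logplane :: "logplane set \<Rightarrow> bool" where
  "open_logplane U \<longleftrightarrow> open (Fin -` U) \<and> (MInf \<in> U \<longrightarrow> (\<exists>x. half_plane x \<subseteq> U))"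

instance
proof
  show "open (UNIV :: logplane set)"
    by (simp add: open_logplane_def)
next
  fix S T :: "logplane set"
  assume S: "open S" and T: "open T"
  have "\<exists>x. half_plane x \<subseteq> S \<inter> T" if m: "MInf \<in> S \<inter> T"
  proof -
    obtain x y where "half_plane x \<subseteq> S" "half_plane y \<subseteq> T"
      using S T m by (auto simp: open_logplane_def)
    moreover have "half_plane (min x y) \<subseteq> half_plane x \<inter> half_plane y"
      by (auto simp: half_plane_def)
    ultimately show ?thesis by blast
  qed
  then show "open (S \<inter> T)"
    using S T by (auto simp: open_logplane_def vimage_Int intro: open_Int)
next
  fix \<U> :: "logplane set set"
  assume U: "\<forall>S\<in>\<U>. open S"
  have "\<exists>x. half_plane x \<subseteq> \<Union>\<U>" if "MInf \<in> \<Union>\<U>"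
    using that U unfolding open_logplane_def by blast
  moreover have "open (Fin -` \<Union>\<U>)"
    using U unfolding vimage_Union open_logplane_def by blast
  ultimately show "open (\<Union>\<U>)"
    by (simp add: open_logplane_def)
qed

end

lemma open_Fin_image: "open (Fin ` A) \<longleftrightarrow> open A"
proof -
  have "Fin -` Fin ` A = A" by auto
  then show ?thesis by (auto simp: open_logplane_def)
qed

lemma open_half_plane: "open (half_plane x)"
proof -
  have "Fin -` half_plane x = {z. Re z < x}" by (auto simp: half_plane_def)
  then show ?thesis by (auto simp: open_logplane_def open_halfspace_Re_lt)
qed

definition log_domain :: "logplane set \<Rightarrow> bool" where
  "log_domain D \<longleftrightarrow> open (Fin -` D) \<and> connected (Fin -` D) \<and> Fin -` D \<noteq> {}"

definition log_holomorphic_on :: "(logplane \<Rightarrow> complex) \<Rightarrow> logplane set \<Rightarrow> bool" where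
  "log_holomorphic_on f D \<longleftrightarrow> continuous_on D f \<and> (\<lambda>z. f (Fin z)) holomorphic_on (Fin -` D)"

section \<open>Generalized power series\<close>

definition natural_set :: "real set \<Rightarrow> bool" where
  "natural_set \<Delta> \<longleftrightarrow> (\<forall>a. finite (\<Delta> \<inter> {..<a}))"

text \<open>A generalized power series is represented by its coefficient function.\<close>

definition gps_support :: "(real \<Rightarrow> complex) \<Rightarrow> real set" where
  "gps_support F = {\<alpha>. F \<alpha> \<noteq> 0}"

definition gen_power_series :: "(real \<Rightarrow> complex) set" where
  "gen_power_series = {F. gps_support F \<subseteq> {0..} \<and>
     (\<forall>A \<subseteq> gps_support F. A \<noteq> {} \<longrightarrow> (\<exists>a\<in>A. \<forall>b\<in>A. a \<le> b))}"

definition gps_norm :: "real \<Rightarrow> (real \<Rightarrow> complex) \<Rightarrow> ennreal" where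
  "gps_norm s F = (\<Sum>\<^sub>\<infinity>\<alpha>\<in>{0..}. ennreal (cmod (F \<alpha>) * s powr \<alpha>))"

definition conv_gen_power_series :: "(real \<Rightarrow> complex) set" where
  "conv_gen_power_series = {F \<in> gen_power_series. \<exists>s>0. gps_norm s F < \<infinity>}"

text \<open>The function sending \<open>w\<close> to the exponential of \<open>\<alpha> w\<close>, for \<open>\<alpha> \<ge> 0\<close>.  At minus infinity it is
  extended by continuity; in particular it is constantly 1 for \<open>\<alpha> = 0\<close>.\<close>

fun log_monomial :: "real \<Rightarrow> logplane \<Rightarrow> complex" where
  "log_monomial \<alpha> (Fin z) = exp (of_real \<alpha> * z)"
| "log_monomial \<alpha> MInf = (if \<alpha> = 0 then 1 else 0)"

definition log_sum :: "(real \<Rightarrow> complex) \<Rightarrow> logplane \<Rightarrow> complex" where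
  "log_sum F w = (\<Sum>\<^sub>\<infinity>\<alpha>\<in>{0..}. F \<alpha> * log_monomial \<alpha> w)"

section \<open>Generalized multisummable functions\<close>

definition rho :: "real \<Rightarrow> real \<Rightarrow> nat \<Rightarrow> real" where
  "rho R k p = R / (1 + real p) powr k"

definition strip_nbhd :: "real \<Rightarrow> real \<Rightarrow> real \<Rightarrow> nat \<Rightarrow> logplane set" where
  "strip_nbhd R \<theta> k p = closure (strip (ln R) (\<theta> * k) \<union> half_plane (ln (rho R k p)))"

lemma strip_nbhd_0: "strip_nbhd R \<theta> 0 p = closure (half_plane (ln R))"
proof -
  have "strip (ln R) (\<theta> * 0) \<union> half_plane (ln (rho R 0 p)) = half_plane (ln R)"
    by (auto simp: strip_def half_plane_def rho_def)
  then show ?thesis by (simp only: strip_nbhd_def)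
qed

definition S_tau :: "real set \<Rightarrow> real \<Rightarrow> real \<Rightarrow> logplane set" where
  "S_tau K R \<theta> =
     (if K = {0} then half_plane (ln R) else (\<Inter>k\<in>K - {0}. strip (ln R) (\<theta> * k)))"

definition rho_tau :: "real set \<Rightarrow> real \<Rightarrow> nat \<Rightarrow> real" where
  "rho_tau K R p = Min ((\<lambda>k. rho R k p) ` K)"

definition S_tau_p :: "real set \<Rightarrow> real \<Rightarrow> real \<Rightarrow> nat \<Rightarrow> logplane set" where
  "S_tau_p K R \<theta> p = (\<Inter>k\<in>K. strip_nbhd R \<theta> k p)"

text \<open>\<open>multisum_repr K R r \<theta> \<Delta> f fs Fs\<close> states that \<open>f\<close> is the sum of the \<open>fs p\<close> with respect to
  \<open>(K, R, r, \<theta>, \<Delta>)\<close>, the series \<open>Fs p\<close> having log-sum \<open>fs p\<close>.  Norms and suprema are taken in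
  \<open>ennreal\<close>, so that being less than \<open>\<infinity>\<close> includes the finiteness of every term.\<close>

definition multisum_repr ::
  "real set \<Rightarrow> real \<Rightarrow> real \<Rightarrow> real \<Rightarrow> real set \<Rightarrow> (logplane \<Rightarrow> complex) \<Rightarrow>
   (nat \<Rightarrow> logplane \<Rightarrow> complex) \<Rightarrow> (nat \<Rightarrow> real \<Rightarrow> complex) \<Rightarrow> bool" where
  "multisum_repr K R r \<theta> \<Delta> f fs Fs \<longleftrightarrow>
     (\<forall>p. \<exists>D g. log_domain D \<and> S_tau_p K R \<theta> p \<subseteq> D \<and> log_holomorphic_on g D \<and>
                (\<forall>w\<in>S_tau_p K R \<theta> p. fs p w = g w)) \<and>
     (\<forall>p. Fs p \<in> conv_gen_power_series \<and> gps_support (Fs p) \<subseteq> \<Delta> \<and>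
          gps_norm (rho_tau K R p) (Fs p) < \<infinity> \<and>
          (\<forall>w\<in>half_plane (ln (rho_tau K R p)). fs p w = log_sum (Fs p) w)) \<and>
     (\<Sum>p. gps_norm (rho_tau K R p) (Fs p) * ennreal (r ^ p)) < \<infinity> \<and>
     (\<Sum>p. (SUP w\<in>S_tau_p K R \<theta> p. ennreal (cmod (fs p w))) * ennreal (r ^ p)) < \<infinity> \<and>
     (\<forall>w\<in>S_tau K R \<theta>. (\<lambda>p. fs p w) sums f w)"

text \<open>Functions on \<open>S_tau\<close> are represented by extensional functions, so that two of them are equal
  iff they agree on \<open>S_tau\<close>.\<close>

definition multisummable ::
  "real set \<Rightarrow> real \<Rightarrow> real \<Rightarrow> real \<Rightarrow> real set \<Rightarrow> (logplane \<Rightarrow> complex) set" where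
  "multisummable K R r \<theta> \<Delta> =
     {f \<in> extensional (S_tau K R \<theta>). log_holomorphic_on f (S_tau K R \<theta>) \<and>
        (\<exists>fs Fs. multisum_repr K R r \<theta> \<Delta> f fs Fs)}"

text \<open>The series \<open>T_map f\<close>, whose coefficient at \<open>\<alpha>\<close> is the sum of the coefficients at \<open>\<alpha>\<close> of the
  series in a representation of \<open>f\<close>, does not depend on that representation.\<close>

definition T_map ::
  "real set \<Rightarrow> real \<Rightarrow> real \<Rightarrow> real \<Rightarrow> real set \<Rightarrow> (logplane \<Rightarrow> complex) \<Rightarrow> (real \<Rightarrow> complex)" where
  "T_map K R r \<theta> \<Delta> f =
     (THE F. \<exists>fs Fs. multisum_repr K R r \<theta> \<Delta> f fs Fs \<and> F = (\<lambda>\<alpha>. \<Sum>p. Fs p \<alpha>))"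

end

theory Submission
  imports Defs
begin

text \<open>
  Write $g_N = \sum_{p \le N} f_p$. If all coefficients $\sum_p a_{p,\alpha}$ vanish, then the partial
  sums of the coefficients equal minus their tails, which makes $g_N$ exponentially small in $N$ on
  the line $\mathrm{Re}\, w = \log \rho^\tau_N - 1$. This smallness is carried to the right through
  the levels $k$ of $K$ in decreasing order, down to level $0$, where it says that $g_N$ tends to $0$
  on a vertical segment not depending on $N$; by the identity theorem $f = 0$. One step, from $k$ to
  the next smaller level $k'$, is a relative form of Watson's lemma. It uses that $f_p$ lives on a
  half-strip of width greater than $\pi k$ ending at $\log R - k' \log(1+p)$, and it consists of
  Cauchy's formula for $g_N$ and for the later $f_p$ on rectangles with a common left edge, with a
  weight $\exp(M e^{-\beta w})$, $\beta < 1/k$, that is harmless for the differences $g_{p+1} - g_p$.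

  That the series does not depend on the representation follows by applying Tannery's theorem to
  $e^{-\alpha w} \sum_p (f_p(w) - \sum_{\beta < \alpha} a_{p,\beta} e^{\beta w})$ as $w \to -\infty$.
\<close>

section \<open>Relative Watson lemma\<close>

text \<open>Watson's lemma cannot simply be applied to \<open>f\<close>. Vanishing coefficients make
  \<open>f\<close> flat of order \<open>kmax\<close> only, whereas the half-width of
  \<open>S_tau\<close> is \<theta> times the least nonzero level; on a half-strip of half-width
  below pi * kmax / 2 the function exp (- exp (- w / kmax)) is flat and nonzero. The partial sums
  escape this: between consecutive levels k' < k each \<open>f p\<close> lives on a half-strip of
  half-width \<theta> * k, at the price of a right end that recedes as \<open>p\<close> grows. The
  hypothesis \<theta> > pi / 2 is what leaves room for a weight with \<beta> * k < 1.

  For fixed \<open>N\<close> nothing is known about g_N far to the left; only g_P is small there, at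
  distance about k * ln (1 + P). Hence the detour through the integral J over a common left edge:
  J(g_N) is J(g_P) minus the J(f_p) with N < p \<le> P. The point \<open>w\<close> lies outside the
  rectangle of each such f_p, so J(f_p) is governed by the three other edges, where the geometric
  decay of f_p pays for the weight. No final bound involves \<open>P\<close>.\<close>

text \<open>exp is its own antiderivative, so the integral of the majorant over the edge is a
  difference of end values and the length of the edge drops out.\<close>

lemma has_contour_integral_bound_horizontal:
  assumes h: "(h has_contour_integral i) (linepath a b)" and im: "Im a = Im b" and B: "0 \<le> B"
    and le: "\<And>z. z \<in> closed_segment a b \<Longrightarrow> cmod (h z) \<le> B * exp (Re z)"
  shows "cmod i \<le> B * exp (max (Re a) (Re b))"
proof -
  define d where "d = Re b - Re a"
  define g where "g t = B * exp (Re a + t * d) * \<bar>d\<bar>" for t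
  have ab: "b - a = of_real d"
    using im by (simp add: d_def complex_eq_iff)
  have i: "((\<lambda>t. h (linepath a b t) * (b - a)) has_integral i) {0..1}"
    using h by (simp add: has_contour_integral_linepath)
  \<comment> \<open>The antiderivative of \<open>g\<close> is sgn d * B * exp (Re a + t * d); the
    sign covers both orientations and d = 0.\<close>
  have "(g has_integral sgn d * B * exp (Re a + 1 * d) - sgn d * B * exp (Re a + 0 * d)) {0..1}"
    unfolding g_def
    by (rule fundamental_theorem_of_calculus)
       (auto intro!: derivative_eq_intros simp: has_real_derivative_iff_has_vector_derivative[symmetric]
         abs_sgn)
  then have g: "(g has_integral sgn d * (B * exp (Re b) - B * exp (Re a))) {0..1}"
    by (simp add: d_def algebra_simps)
  have "cmod (h (linepath a b t) * (b - a)) \<le> g t" if "t \<in> {0..1}" for t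
  proof -
    have "Re (linepath a b t) = Re a + t * d"
      by (simp add: linepath_def d_def algebra_simps)
    moreover have "cmod (h (linepath a b t)) \<le> B * exp (Re (linepath a b t))"
      by (intro le) (use that linepath_in_path in blast)
    ultimately show ?thesis
      unfolding g_def ab norm_mult norm_of_real by (intro mult_right_mono) auto
  qed
  then have "cmod i \<le> sgn d * (B * exp (Re b) - B * exp (Re a))"
    using integral_norm_bound_integral[OF has_integral_integrable[OF i] has_integral_integrable[OF g]]
      i g by (metis (no_types, lifting) integral_unique)
  also have "\<dots> \<le> B * exp (max (Re a) (Re b))"
    using B by (cases d "0::real" rule: linorder_cases) (auto simp: d_def max_def)
  finally show ?thesis .
qed

text \<open>The factor \<open>exp (z - w)\<close> makes the kernel integrable along the horizontal edges, so that the
  estimates do not depend on the length of the rectangle.\<close>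

definition cauchy_kernel :: "complex \<Rightarrow> complex \<Rightarrow> complex" where
  "cauchy_kernel w z = exp (z - w) / (z - w)"

text \<open>Runs downwards, as the left edge of a counterclockwise rectangle. It is a quantity of
  its own because rectangles with different right ends share it.\<close>

definition left_edge_integral :: "real \<Rightarrow> real \<Rightarrow> complex \<Rightarrow> (complex \<Rightarrow> complex) \<Rightarrow> complex" where
  "left_edge_integral X A w F =
     contour_integral (linepath (Complex X A) (Complex X (- A))) (\<lambda>z. F z * cauchy_kernel w z)"

lemma continuous_on_cauchy_kernel:
  "w \<notin> S \<Longrightarrow> continuous_on S F \<Longrightarrow> continuous_on S (\<lambda>z. F z * cauchy_kernel w z)"
  unfolding cauchy_kernel_def by (intro continuous_intros) auto

text \<open>Cauchy's formula if \<open>w\<close> is inside, Cauchy's theorem if it is beyond the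
  right edge; the first case serves g_N, the second the later \<open>f p\<close>. \<open>B0\<close>
  and \<open>B1\<close> are kept apart because the weight has modulus 1 on the horizontal edges but
  is large on the right one.\<close>

lemma cauchy_rectangle_estimate:
  assumes U: "open U" "convex U" and F: "F holomorphic_on U"
    and cb: "\<And>z. X \<le> Re z \<Longrightarrow> Re z \<le> b \<Longrightarrow> \<bar>Im z\<bar> \<le> A \<Longrightarrow> z \<in> U"
    and "X < Re w" "X < b" "Re w \<noteq> b" "\<bar>Im w\<bar> \<le> A'" "A' < A"
    and B0: "\<And>z. X \<le> Re z \<Longrightarrow> Re z \<le> b \<Longrightarrow> \<bar>Im z\<bar> = A \<Longrightarrow> cmod (F z) \<le> B0"
    and B1: "\<And>z. Re z = b \<Longrightarrow> \<bar>Im z\<bar> \<le> A \<Longrightarrow> cmod (F z) \<le> B1"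
  shows "cmod ((if Re w < b then 2 * pi * \<i> * F w else 0) - left_edge_integral X A w F)
           \<le> 2 * B0 * exp (b - Re w) / (A - A') + 2 * A * B1 * exp (b - Re w) / \<bar>b - Re w\<bar>"
proof -
  define H where "H z = F z * cauchy_kernel w z" for z
  define p1 p2 p3 p4 where "p1 = Complex X (- A)" and "p2 = Complex b (- A)"
    and "p3 = Complex b A" and "p4 = Complex X A"
  have A: "A > 0"
    using assms by linarith
  have "cmod (F (Complex b A)) \<le> B0" "cmod (F (Complex b A)) \<le> B1"
    using A \<open>X < b\<close> by (auto intro: B0 B1)
  then have B0': "B0 \<ge> 0" and B1': "B1 \<ge> 0"
    by (meson norm_ge_zero order_trans)+
  have segs: "closed_segment p1 p2 = {z. Im z = -A \<and> Re z \<in> {X..b}}"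
     "closed_segment p2 p3 = {z. Re z = b \<and> Im z \<in> {-A..A}}"
     "closed_segment p3 p4 = {z. Im z = A \<and> Re z \<in> {X..b}}"
     "closed_segment p4 p1 = {z. Re z = X \<and> Im z \<in> {-A..A}}"
    using A \<open>X < b\<close> by (auto simp: p1_def p2_def p3_def p4_def closed_segment_same_Re
      closed_segment_same_Im closed_segment_eq_real_ivl)
  have notin: "w \<notin> closed_segment p1 p2" "w \<notin> closed_segment p2 p3"
     "w \<notin> closed_segment p3 p4" "w \<notin> closed_segment p4 p1"
    using assms by (auto simp: segs)
  have inU: "closed_segment p1 p2 \<subseteq> U" "closed_segment p2 p3 \<subseteq> U"
     "closed_segment p3 p4 \<subseteq> U" "closed_segment p4 p1 \<subseteq> U"
    using A \<open>X < b\<close> by (auto simp: segs intro!: cb)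
  have ci: "H contour_integrable_on linepath u v"
    if "w \<notin> closed_segment u v" "closed_segment u v \<subseteq> U" for u v
    unfolding H_def using that F
    by (intro contour_integrable_continuous_linepath continuous_on_cauchy_kernel)
       (auto intro: holomorphic_on_imp_continuous_on holomorphic_on_subset)
  note cis = ci[OF notin(1) inU(1)] ci[OF notin(2) inU(2)] ci[OF notin(3) inU(3)] ci[OF notin(4) inU(4)]
  define I where "I = (\<lambda>u v. contour_integral (linepath u v) H)"
  have rect: "rectpath p1 p3 = linepath p1 p2 +++ linepath p2 p3 +++ linepath p3 p4 +++ linepath p4 p1"
    by (simp add: rectpath_def Let_def p1_def p2_def p3_def p4_def)
  have "(H has_contour_integral (I p1 p2 + (I p2 p3 + (I p3 p4 + I p4 p1)))) (rectpath p1 p3)"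
    unfolding rect I_def
    by (intro has_contour_integral_join has_contour_integral_integral cis valid_path_join)
       auto
  moreover have "(H has_contour_integral (if Re w < b then 2 * pi * \<i> * F w else 0)) (rectpath p1 p3)"
  proof (cases "Re w < b")
    case True
    have im: "path_image (rectpath p1 p3) \<subseteq> U - {w}"
      using inU notin by (auto simp: rect path_image_join)
    have wU: "w \<in> U"
      using True assms by (intro cb) auto
    have "w \<in> box p1 p3"
      using True assms by (auto simp: in_box_complex_iff p1_def p3_def)
    then have "winding_number (rectpath p1 p3) w = 1"
      by (rule winding_number_rectpath)
    moreover have "(\<lambda>z. F z * exp (z - w)) holomorphic_on U"
      by (intro holomorphic_intros F)
    then have "((\<lambda>z. F z * exp (z - w) / (z - w)) has_contour_integral
       (2*pi * \<i> * winding_number (rectpath p1 p3) w * (F w * exp (w - w)))) (rectpath p1 p3)"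
      using U im wU by (intro Cauchy_integral_formula_convex_simple) (auto simp: interior_open)
    ultimately show ?thesis
      using True by (simp add: H_def [abs_def] cauchy_kernel_def)
  next
    case False
    then have w: "b < Re w"
      using \<open>Re w \<noteq> b\<close> by simp
    \<comment> \<open>\<open>H\<close> is singular at \<open>w\<close>, so \<open>U\<close> is cut
      off to the left of \<open>w\<close>; the rest is still convex and contains the boundary of the
      rectangle.\<close>
    define V where "V = U \<inter> {z. Re z < Re w}"
    have "path_image (rectpath p1 p3) \<subseteq> V"
      using inU w \<open>X < Re w\<close> unfolding V_def by (auto simp: rect path_image_join segs)
    moreover have "H holomorphic_on V"
      unfolding H_def cauchy_kernel_def V_def
      by (intro holomorphic_intros holomorphic_on_subset[OF F]) auto
    moreover have "convex V"
      unfolding V_def by (intro convex_Int U convex_halfspace_Re_lt)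
    ultimately have "(H has_contour_integral 0) (rectpath p1 p3)"
      by (intro Cauchy_theorem_convex_simple) auto
    then show ?thesis
      using False by simp
  qed
  ultimately have eq: "(if Re w < b then 2 * pi * \<i> * F w else 0) = I p1 p2 + (I p2 p3 + (I p3 p4 + I p4 p1))"
    using has_contour_integral_unique by blast
  have I41: "I p4 p1 = left_edge_integral X A w F"
    by (simp add: I_def left_edge_integral_def p4_def p1_def H_def [abs_def])
  have hor: "cmod (H z) \<le> B0 * exp (- Re w) / (A - A') * exp (Re z)"
    if "\<bar>Im z\<bar> = A" "X \<le> Re z" "Re z \<le> b" for z
  proof -
    have "A - A' \<le> \<bar>Im (z - w)\<bar>"
      using that assms by auto
    also have "\<dots> \<le> cmod (z - w)"
      by (rule abs_Im_le_cmod)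
    finally have "exp (Re z - Re w) / cmod (z - w) \<le> exp (Re z - Re w) / (A - A')"
      using assms by (intro divide_left_mono mult_pos_pos) auto
    then have "cmod (F z) * (exp (Re z - Re w) / cmod (z - w)) \<le> B0 * (exp (Re z - Re w) / (A - A'))"
      using that assms B0' by (intro mult_mono B0) auto
    then show ?thesis
      by (simp add: H_def cauchy_kernel_def norm_mult norm_divide exp_diff exp_minus divide_simps)
  qed
  have B0'': "0 \<le> B0 * exp (- Re w) / (A - A')"
    using B0' assms by auto
  have 1: "cmod (I p1 p2) \<le> B0 * exp (- Re w) / (A - A') * exp (max (Re p1) (Re p2))"
    unfolding I_def
  proof (rule has_contour_integral_bound_horizontal[OF has_contour_integral_integral[OF cis(1)] _ B0''])
    show "cmod (H z) \<le> B0 * exp (- Re w) / (A - A') * exp (Re z)" if "z \<in> closed_segment p1 p2" for z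
      using that A by (intro hor) (auto simp: segs)
  qed (simp add: p1_def p2_def)
  have 3: "cmod (I p3 p4) \<le> B0 * exp (- Re w) / (A - A') * exp (max (Re p3) (Re p4))"
    unfolding I_def
  proof (rule has_contour_integral_bound_horizontal[OF has_contour_integral_integral[OF cis(3)] _ B0''])
    show "cmod (H z) \<le> B0 * exp (- Re w) / (A - A') * exp (Re z)" if "z \<in> closed_segment p3 p4" for z
      using that A by (intro hor) (auto simp: segs)
  qed (simp add: p3_def p4_def)
  have "cmod (I p2 p3) \<le> B1 * exp (b - Re w) / \<bar>b - Re w\<bar> * cmod (p3 - p2)"
    unfolding I_def
  proof (rule has_contour_integral_bound_linepath)
    show "0 \<le> B1 * exp (b - Re w) / \<bar>b - Re w\<bar>"
      using B1' by auto
    fix z assume z: "z \<in> closed_segment p2 p3"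
    then have "Re z = b"
      by (auto simp: segs)
    then have "\<bar>b - Re w\<bar> \<le> cmod (z - w)"
      using abs_Re_le_cmod[of "z - w"] by simp
    then have "exp (Re z - Re w) / cmod (z - w) \<le> exp (b - Re w) / \<bar>b - Re w\<bar>"
      using assms \<open>Re z = b\<close> by (auto intro!: divide_left_mono mult_pos_pos)
    then have "cmod (F z) * (exp (Re z - Re w) / cmod (z - w)) \<le> B1 * (exp (b - Re w) / \<bar>b - Re w\<bar>)"
      using z B1' by (intro mult_mono B1) (auto simp: segs)
    then show "cmod (H z) \<le> B1 * exp (b - Re w) / \<bar>b - Re w\<bar>"
      by (simp add: H_def cauchy_kernel_def norm_mult norm_divide)
  qed (use cis in \<open>auto simp: has_contour_integral_integral\<close>)
  also have "p3 - p2 = of_real (2 * A) * \<i>"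
    by (simp add: p3_def p2_def complex_eq_iff)
  finally have 2: "cmod (I p2 p3) \<le> B1 * exp (b - Re w) / \<bar>b - Re w\<bar> * (2 * A)"
    using A by (simp add: norm_mult)
  have max: "max (Re p1) (Re p2) = b" "max (Re p3) (Re p4) = b"
    using \<open>X < b\<close> by (auto simp: p1_def p2_def p3_def p4_def)
  have e: "exp (b - Re w) = exp (- Re w) * exp b"
    by (simp flip: exp_add)
  have "cmod ((if Re w < b then 2 * pi * \<i> * F w else 0) - left_edge_integral X A w F)
        = cmod (I p1 p2 + I p2 p3 + I p3 p4)"
    unfolding eq I41 by (simp add: algebra_simps)
  also have "\<dots> \<le> cmod (I p1 p2) + cmod (I p2 p3) + cmod (I p3 p4)"
    by (meson add_right_mono norm_triangle_ineq order_trans)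
  also have "\<dots> \<le> 2 * B0 * exp (b - Re w) / (A - A') + 2 * A * B1 * exp (b - Re w) / \<bar>b - Re w\<bar>"
  proof -
    have "2 * B0 * exp (b - Re w) / (A - A') = 2 * (B0 * exp (- Re w) / (A - A') * exp b)"
      and "2 * A * B1 * exp (b - Re w) / \<bar>b - Re w\<bar> = B1 * exp (b - Re w) / \<bar>b - Re w\<bar> * (2 * A)"
      by (simp_all add: e)
    then show ?thesis
      using 1 2 3 unfolding max by linarith
  qed
  finally show ?thesis .
qed

text \<open>For \<open>k = 0\<close> the vertical segment does not depend on \<open>N\<close>, and the partial sums tend to 0 on it.\<close>

definition exp_small :: "(nat \<Rightarrow> complex \<Rightarrow> complex) \<Rightarrow> real \<Rightarrow> real \<Rightarrow> bool" where
  "exp_small f c k \<longleftrightarrow> (\<exists>A \<delta> \<eta> C. pi * k / 2 < A \<and> 0 < \<delta> \<and> 0 < \<eta> \<and>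
     (\<forall>N w. Re w = c - k * ln (1 + real N) - \<delta> \<longrightarrow> \<bar>Im w\<bar> < A \<longrightarrow>
        cmod (\<Sum>p\<le>N. f p w) \<le> C * exp (- \<eta> * real N)))"

text \<open>With \<open>\<beta> = pi / (2 * A)\<close> the weight \<open>E\<close> below has modulus 1 on the horizontal edges and is large at
  \<open>w\<close>. The choice of \<open>M\<close> keeps it below \<open>exp (\<nu> * (1 + p))\<close> on the right edge belonging to \<open>f p\<close>, while
  \<open>\<beta> * k < 1\<close> makes the contribution of the common left edge negligible as that edge moves to the
  left.\<close>

lemma exp_small_step:
  assumes k: "0 \<le> k'" "k' < k" and B: "pi * k / 2 < B" and q: "0 < q" "q < 1"
    and hol: "\<And>p. f p holomorphic_on {w. Re w < c - k' * ln (1 + real p) \<and> \<bar>Im w\<bar> < B}"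
    and bd: "\<And>p w. Re w < c - k' * ln (1 + real p) \<Longrightarrow> \<bar>Im w\<bar> < B \<Longrightarrow> cmod (f p w) \<le> C * q ^ p"
    and small: "exp_small f c k"
  shows "exp_small f c k'"
proof -
  obtain A0 \<delta> \<eta> C0 where A0: "pi * k / 2 < A0" and "0 < \<delta>" "0 < \<eta>" and
    left: "\<And>N w. Re w = c - k * ln (1 + real N) - \<delta> \<Longrightarrow> \<bar>Im w\<bar> < A0 \<Longrightarrow>
        cmod (\<Sum>p\<le>N. f p w) \<le> C0 * exp (- \<eta> * real N)"
    using small unfolding exp_small_def by blast
  \<comment> \<open>Below \<open>A0\<close>, where the partial sums are known to be small, and below
    \<open>B\<close>, where the \<open>f p\<close> live, yet above pi * k / 2, which is what \<beta>
    * k < 1 needs.\<close>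
  define A where "A = (pi * k / 2 + min A0 B) / 2"
  define \<beta> where "\<beta> = pi / (2 * A)"
  \<comment> \<open>The height for the conclusion. The slack A - A' keeps \<open>w\<close> away from
    the horizontal edges and the cosine in the weight away from 0.\<close>
  define A' where "A' = (pi * k' / 2 + A) / 2"
  have A: "pi * k / 2 < A" "A < A0" "A < B"
    using A0 B by (auto simp: A_def min_def field_simps)
  have "pi * k > 0" "pi * k' \<ge> 0"
    using k by auto
  then have Apos: "A > 0"
    using A by linarith
  have kk: "pi * k' / 2 < pi * k / 2"
    using k by simp
  then have lt: "pi * k' / 2 < A"
    using A by linarith
  have A': "pi * k' / 2 < A'" "A' < A"
    using less_half_sum[OF lt] gt_half_sum[OF lt] by (simp_all add: A'_def)
  then have "A' > 0"
    using \<open>pi * k' \<ge> 0\<close> by linarith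
  note A' = A' this
  have \<beta>: "\<beta> > 0" "\<beta> * A = pi / 2" "\<beta> * k < 1"
    using Apos A by (auto simp: \<beta>_def field_simps)
  have \<beta>k': "\<beta> * k' < 1"
    using \<beta> k by (meson mult_less_cancel_left_pos order.strict_trans)
  define \<gamma> where "\<gamma> = cos (\<beta> * A')"
  have "\<beta> * A' < pi / 2"
    using \<beta> A' by (metis mult_less_cancel_left_pos)
  then have \<gamma>: "0 < \<gamma>" "\<gamma> \<le> 1"
    using \<beta> A' by (auto simp: \<gamma>_def intro!: cos_gt_zero)
  \<comment> \<open>\<gamma> bounds the cosine from below on height A'. With this \<delta>1 the
    exponent of the weight at \<open>w\<close> is at least twice its bound on the right edge for
    g_N, which lies \<delta>1 to the right of \<open>w\<close>.\<close>
  define \<delta>1 where "\<delta>1 = ln (2 / \<gamma>) / \<beta>"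
  have \<delta>1: "\<delta>1 > 0" "exp (\<beta> * \<delta>1) * \<gamma> = 2"
    using \<gamma> \<beta> by (auto simp: \<delta>1_def)
  \<comment> \<open>Half of the decay rate of q ^ p is spent on the weight; the other half makes the
    later contributions summable.\<close>
  define \<nu> where "\<nu> = - ln q / 2"
  have \<nu>: "\<nu> > 0"
    using q by (simp add: \<nu>_def)
  have qexp: "q ^ p = exp (- 2 * \<nu> * real p)" for p
  proof -
    have "q ^ p = exp (real p * ln q)"
      unfolding exp_of_nat_mult using q by simp
    then show ?thesis
      by (simp add: \<nu>_def mult.commute)
  qed
  \<comment> \<open>The right edge for \<open>f p\<close> lies \<delta>1 + 2 to the left of the end
    of its domain; this \<mu> brings the exponent of the weight there down to \<nu> * (1 +
    p).\<close>
  define \<mu> where "\<mu> = \<nu> / exp (\<beta> * (\<delta>1 + 2))"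
  have \<mu>: "\<mu> > 0" "\<mu> * exp (\<beta> * (\<delta>1 + 2)) = \<nu>"
    using \<nu> by (auto simp: \<mu>_def)
  define C1 where "C1 = (\<Sum>p. C * q ^ p)"
  have C: "C \<ge> 0"
  proof -
    have "0 \<le> cmod (f 0 (of_real (c - 1)))"
      by simp
    also have "\<dots> \<le> C * q ^ 0"
      using Apos A by (intro bd) auto
    finally show ?thesis
      by simp
  qed
  have sq: "summable (\<lambda>p. C * q ^ p)"
    using q by (intro summable_mult summable_geometric) auto
  have C1: "C1 \<ge> 0"
    unfolding C1_def using C q by (intro suminf_nonneg sq) auto
  \<comment> \<open>The half-strips shrink as \<open>p\<close> grows, so a point of the one for
    \<open>N\<close> lies in all earlier ones, and the geometric bounds add up uniformly in
    \<open>N\<close>.\<close>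
  have C1_le: "cmod (\<Sum>p\<le>N. f p z) \<le> C1"
    if "Re z < c - k' * ln (1 + real N)" "\<bar>Im z\<bar> < B" for N z
  proof -
    have "cmod (\<Sum>p\<le>N. f p z) \<le> (\<Sum>p\<le>N. C * q ^ p)"
    proof (intro sum_norm_le bd)
      fix p assume "p \<in> {..N}"
      then have "k' * ln (1 + real p) \<le> k' * ln (1 + real N)"
        using k by (intro mult_left_mono) auto
      then show "Re z < c - k' * ln (1 + real p)"
        using that by linarith
    qed (use that in auto)
    also have "\<dots> \<le> C1"
      unfolding C1_def using C q by (intro sum_le_suminf sq) auto
    finally show ?thesis .
  qed
  define D where "D = (2 / (A - A') + 2 * A) * (C * exp \<nu>)"
  define S where "S = (\<Sum>p. D * exp (- \<nu>) ^ p)"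
  have D: "D \<ge> 0"
    using C A' Apos by (auto simp: D_def)
  have sD: "summable (\<lambda>p. D * exp (- \<nu>) ^ p)"
    using \<nu> by (intro summable_mult summable_geometric) auto
  have S: "S \<ge> 0"
    unfolding S_def using D by (intro suminf_nonneg sD) auto
  \<comment> \<open>In this order: the common left edge, the horizontal edges and the right edge of
    the rectangle for g_N, and the later \<open>f p\<close>.\<close>
  define C2 where "C2 = 2 * A * \<bar>C0\<bar> + 2 * C1 * exp \<delta>1 / (A - A') + 2 * A * C1 * exp \<delta>1 / \<delta>1 + S"
  have "cmod (\<Sum>p\<le>N. f p w) \<le> C2 * exp (- (\<mu> * exp \<beta>) * real N)"
    if w: "Re w = c - k' * ln (1 + real N) - (1 + \<delta>1)" "\<bar>Im w\<bar> < A'" for N w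
  proof -
    \<comment> \<open>The exponent makes M * (1 + p) powr (\<beta> * k') equal to \<mu> * (1 + N) at
      p = N and, being positive, at most \<mu> * (1 + p) for later \<open>p\<close>.\<close>
    define M where "M = \<mu> * (1 + real N) powr (1 - \<beta> * k')"
    have M: "M > 0"
      using \<mu> by (simp add: M_def)
    have pw: "exp (\<beta> * k' * ln (1 + real p)) = (1 + real p) powr (\<beta> * k')" for p
      by (simp add: powr_def)
    have MN: "M * exp (\<beta> * k' * ln (1 + real N)) = \<mu> * (1 + real N)"
      unfolding M_def pw by (simp add: mult.assoc powr_add[symmetric])
    have Mp: "M * exp (\<beta> * k' * ln (1 + real p)) \<le> \<mu> * (1 + real p)" if "N \<le> p" for p
    proof -
      have "M * exp (\<beta> * k' * ln (1 + real p))
            \<le> \<mu> * ((1 + real p) powr (1 - \<beta> * k') * (1 + real p) powr (\<beta> * k'))"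
        unfolding M_def pw using that \<mu> \<beta>k'
        by (subst mult.assoc, intro mult_left_mono mult_right_mono powr_mono2) auto
      then show ?thesis
        by (subst (asm) powr_add[symmetric]) simp
    qed
    define E where "E z = exp (of_real M * exp (- of_real \<beta> * (z - of_real c)))" for z :: complex
    have cE: "cmod (E z) = exp (M * exp (\<beta> * (c - Re z)) * cos (\<beta> * Im z))" for z
      by (simp add: E_def Re_exp algebra_simps)
    have EA: "cmod (E z) = 1" if "\<bar>Im z\<bar> = A" for z
    proof -
      have "cos (\<beta> * Im z) = cos (\<beta> * A)"
        using that by (cases "Im z \<ge> 0") auto
      then show ?thesis
        using \<beta> by (simp add: cE)
    qed
    have EB: "cmod (E z) \<le> exp (M * exp (\<beta> * (c - Re z)))" for z
      unfolding cE using M mult_left_mono[of "cos (\<beta> * Im z)" 1 "M * exp (\<beta> * (c - Re z))"] by simp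
    have E_hol: "E holomorphic_on T" for T
      unfolding E_def by (intro holomorphic_intros)
    \<comment> \<open>The second condition puts the line on which g_P is small to the left of all
      right edges; the third, where the left side is sublinear because \<beta> * k < 1, keeps the
      weight on that line below exp (\<eta> * P).\<close>
    have "\<forall>\<^sub>F P in sequentially. N < P \<and> (k - k') * ln (1 + real P) + \<delta> > \<delta>1 + 2 \<and>
            M * exp (\<beta> * \<delta>) * (1 + real P) powr (\<beta> * k) \<le> \<eta> * real P"
    proof (intro eventually_conj)
      show "\<forall>\<^sub>F P in sequentially. N < P"
        by (rule eventually_gt_at_top)
      have "filterlim (\<lambda>P. (k - k') * ln (1 + real P) + \<delta>) at_top sequentially"
        using k by real_asymp
      then show "\<forall>\<^sub>F P in sequentially. (k - k') * ln (1 + real P) + \<delta> > \<delta>1 + 2"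
        by (simp add: filterlim_at_top_dense)
      define s where "s = \<beta> * k"
      define m where "m = M * exp (\<beta> * \<delta>)"
      have "s < 1" "s > 0" "m > 0"
        using \<beta> k M by (auto simp: s_def m_def)
      then have "\<forall>\<^sub>F P in sequentially. m * (1 + real P) powr s \<le> \<eta> * real P"
        using \<open>\<eta> > 0\<close> by real_asymp
      then show "\<forall>\<^sub>F P in sequentially. M * exp (\<beta> * \<delta>) * (1 + real P) powr (\<beta> * k) \<le> \<eta> * real P"
        by (simp add: s_def m_def)
    qed
    then have "\<exists>P. N < P \<and> (k - k') * ln (1 + real P) + \<delta> > \<delta>1 + 2 \<and>
            M * exp (\<beta> * \<delta>) * (1 + real P) powr (\<beta> * k) \<le> \<eta> * real P"
      by (rule eventually_happens'[OF sequentially_bot])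
    then obtain P where P: "N < P" "(k - k') * ln (1 + real P) + \<delta> > \<delta>1 + 2"
         "M * exp (\<beta> * \<delta>) * (1 + real P) powr (\<beta> * k) \<le> \<eta> * real P"
      by blast
    define X where "X = c - k * ln (1 + real P) - \<delta>"
    \<comment> \<open>The 2 exceeds the 1 in the position of \<open>w\<close> by 1, so for p \<ge> N
      this edge is at least 1 to the left of \<open>w\<close>.\<close>
    define b where "b p = c - k' * ln (1 + real p) - \<delta>1 - 2" for p
    define U where "U p = {z. Re z < c - k' * ln (1 + real p) \<and> \<bar>Im z\<bar> < B}" for p
    have Uo: "open (U p)" for p
      unfolding U_def by (intro open_Collect_conj open_Collect_less continuous_intros)
    have Uc: "convex (U p)" for p
    proof -
      have "U p = {z. Re z < c - k' * ln (1 + real p)} \<inter> ({z. Im z < B} \<inter> {z. Im z > - B})"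
        by (auto simp: U_def)
      then show ?thesis
        by (simp only:) (intro convex_Int convex_halfspace_Re_lt convex_halfspace_Im_lt convex_halfspace_Im_gt)
    qed
    have kmono: "k' * ln (1 + real p) \<le> k' * ln (1 + real p')" if "p \<le> p'" for p p'
      using that k by (intro mult_left_mono) auto
    have Xb: "X < b p" if "p \<le> P" for p
      using P(2) kmono[OF that] by (simp add: X_def b_def algebra_simps)
    have bw: "b p - Re w \<le> -1" if "N \<le> p" for p
      using kmono[OF that] w(1) by (simp add: b_def)
    have Xw: "X - Re w \<le> -1"
      using Xb[of N] bw[of N] P(1) by simp
    define J where "J F = left_edge_integral X A w F" for F
    define g where "g n z = (\<Sum>p\<le>n. f p z)" for n z

    have estN: "cmod (2 * pi * \<i> * (g N w * E w) - J (\<lambda>z. g N z * E z))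
       \<le> 2 * C1 * exp \<delta>1 / (A - A') + 2 * A * (C1 * exp (\<mu> * exp \<beta> * (1 + real N))) * exp \<delta>1 / \<delta>1"
    proof -
      \<comment> \<open>The 1 only keeps the closed rectangle inside the open half-strip;
        \<open>w\<close> is \<delta>1 to the left of this edge, hence inside.\<close>
      define bN where "bN = c - k' * ln (1 + real N) - 1"
      have bN: "bN - Re w = \<delta>1" "Re w < bN"
        using w \<delta>1 by (auto simp: bN_def)
      have "(\<lambda>z. g N z * E z) holomorphic_on U N"
        unfolding g_def
      proof (intro holomorphic_on_mult holomorphic_on_sum E_hol)
        fix p assume "p \<in> {..N}"
        then have "U N \<subseteq> {z. Re z < c - k' * ln (1 + real p) \<and> \<bar>Im z\<bar> < B}"
          using kmono[of p N] by (auto simp: U_def)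
        then show "f p holomorphic_on U N"
          by (rule holomorphic_on_subset[OF hol])
      qed
      then have "cmod ((if Re w < bN then 2 * pi * \<i> * (g N w * E w) else 0) - J (\<lambda>z. g N z * E z))
       \<le> 2 * C1 * exp (bN - Re w) / (A - A')
          + 2 * A * (C1 * exp (\<mu> * exp \<beta> * (1 + real N))) * exp (bN - Re w) / \<bar>bN - Re w\<bar>"
        unfolding J_def
      proof (rule cauchy_rectangle_estimate[OF Uo Uc])
        fix z assume z: "X \<le> Re z" "Re z \<le> bN" "\<bar>Im z\<bar> \<le> A"
        then show "z \<in> U N"
          using A by (auto simp: U_def bN_def)
      next
        fix z assume z: "X \<le> Re z" "Re z \<le> bN" "\<bar>Im z\<bar> = A"
        then show "cmod (g N z * E z) \<le> C1"
          using A C1_le[of z N] EA[of z] by (auto simp: bN_def g_def norm_mult)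
      next
        fix z assume z: "Re z = bN" "\<bar>Im z\<bar> \<le> A"
        have "exp (\<beta> * (c - Re z)) = exp \<beta> * exp (\<beta> * k' * ln (1 + real N))"
          unfolding exp_add[symmetric] z by (simp add: bN_def algebra_simps)
        then have "M * exp (\<beta> * (c - Re z)) = \<mu> * exp \<beta> * (1 + real N)"
          using MN by (simp add: mult.left_commute mult.commute)
        then have "cmod (E z) \<le> exp (\<mu> * exp \<beta> * (1 + real N))"
          using EB[of z] by simp
        moreover have "cmod (g N z) \<le> C1"
          using z A C1_le[of z N] by (auto simp: bN_def g_def)
        ultimately show "cmod (g N z * E z) \<le> C1 * exp (\<mu> * exp \<beta> * (1 + real N))"
          unfolding norm_mult using C1 by (intro mult_mono) auto
      qed (use bN Xw \<delta>1 w A' in auto)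
      then show ?thesis
        using bN \<delta>1 by simp
    qed

    \<comment> \<open>\<open>w\<close> is outside this rectangle, so the Cauchy value is 0 and the
      estimate bounds the left edge integral itself.\<close>
    have estp: "cmod (J (\<lambda>z. f p z * E z)) \<le> D * exp (- \<nu>) ^ p" if p: "p \<in> {N<..P}" for p
    proof -
      have "(\<lambda>z. f p z * E z) holomorphic_on U p"
        unfolding U_def by (intro holomorphic_intros E_hol hol)
      then have "cmod ((if Re w < b p then 2 * pi * \<i> * (f p w * E w) else 0) - J (\<lambda>z. f p z * E z))
       \<le> 2 * (C * q ^ p) * exp (b p - Re w) / (A - A')
          + 2 * A * (C * q ^ p * exp (\<nu> * (1 + real p))) * exp (b p - Re w) / \<bar>b p - Re w\<bar>"
        unfolding J_def
      proof (rule cauchy_rectangle_estimate[OF Uo Uc])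
        fix z assume z: "X \<le> Re z" "Re z \<le> b p" "\<bar>Im z\<bar> \<le> A"
        then show "z \<in> U p"
          using A \<delta>1 by (auto simp: U_def b_def)
      next
        fix z assume z: "X \<le> Re z" "Re z \<le> b p" "\<bar>Im z\<bar> = A"
        then show "cmod (f p z * E z) \<le> C * q ^ p"
          using A \<delta>1 bd[of z p] EA[of z] by (auto simp: b_def norm_mult)
      next
        fix z assume z: "Re z = b p" "\<bar>Im z\<bar> \<le> A"
        have "exp (\<beta> * (c - Re z)) = exp (\<beta> * (\<delta>1 + 2)) * exp (\<beta> * k' * ln (1 + real p))"
          unfolding exp_add[symmetric] z by (simp add: b_def algebra_simps)
        then have "M * exp (\<beta> * (c - Re z)) \<le> exp (\<beta> * (\<delta>1 + 2)) * (\<mu> * (1 + real p))"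
          using Mp[of p] p by (simp add: mult.left_commute)
        also have "\<dots> = \<nu> * (1 + real p)"
          unfolding \<mu>(2)[symmetric] by simp
        finally have "cmod (E z) \<le> exp (\<nu> * (1 + real p))"
          using EB[of z] by (meson exp_le_cancel_iff order_trans)
        moreover have "cmod (f p z) \<le> C * q ^ p"
          using z A \<delta>1 bd[of z p] by (auto simp: b_def)
        ultimately show "cmod (f p z * E z) \<le> C * q ^ p * exp (\<nu> * (1 + real p))"
          unfolding norm_mult using C q by (intro mult_mono) auto
      qed (use bw[of p] Xb[of p] p Xw w A' in auto)
      also have "(if Re w < b p then 2 * pi * \<i> * (f p w * E w) else 0) = 0"
        using bw[of p] p by auto
      finally have "cmod (J (\<lambda>z. f p z * E z)) \<le> 2 * (C * q ^ p) * exp (b p - Re w) / (A - A')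
          + 2 * A * (C * q ^ p * exp (\<nu> * (1 + real p))) * exp (b p - Re w) / \<bar>b p - Re w\<bar>"
        by simp
      also have "\<dots> \<le> 2 * (C * (exp \<nu> * exp (- \<nu>) ^ p)) * 1 / (A - A')
          + 2 * A * (C * (exp \<nu> * exp (- \<nu>) ^ p)) * 1 / 1"
      proof -
        have e: "exp (- \<nu>) ^ p = exp (- \<nu> * real p)"
          by (simp add: exp_of_nat2_mult[symmetric])
        have 1: "exp (b p - Re w) \<le> 1" "1 \<le> \<bar>b p - Re w\<bar>"
          using bw[of p] p by auto
        have "q ^ p \<le> exp \<nu> * exp (- \<nu>) ^ p"
          using \<nu> unfolding qexp e exp_add[symmetric] by simp
        moreover have "q ^ p * exp (\<nu> * (1 + real p)) = exp \<nu> * exp (- \<nu>) ^ p"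
          unfolding qexp e exp_add[symmetric] by (simp add: algebra_simps)
        moreover have "2 * (C * q ^ p) * exp (b p - Re w) / (A - A')
             \<le> 2 * (C * (exp \<nu> * exp (- \<nu>) ^ p)) * 1 / (A - A')"
          using 1 A' C \<open>q ^ p \<le> _\<close> q by (intro divide_right_mono mult_mono) auto
        moreover have "2 * A * (C * (exp \<nu> * exp (- \<nu>) ^ p)) * exp (b p - Re w) / \<bar>b p - Re w\<bar>
             \<le> 2 * A * (C * (exp \<nu> * exp (- \<nu>) ^ p)) * 1 / 1"
          using 1 Apos C by (intro frac_le mult_mono) auto
        moreover have "C * q ^ p * exp (\<nu> * (1 + real p)) = C * (exp \<nu> * exp (- \<nu>) ^ p)"
          unfolding mult.assoc \<open>q ^ p * exp (\<nu> * (1 + real p)) = _\<close> ..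
        ultimately show ?thesis
          by (simp only: add_mono)
      qed
      also have "\<dots> = D * exp (- \<nu>) ^ p"
        by (simp add: D_def algebra_simps)
      finally show ?thesis .
    qed

    define seg where "seg = closed_segment (Complex X A) (Complex X (- A))"
    have seg: "seg \<subseteq> {z. Re z = X \<and> \<bar>Im z\<bar> \<le> A}"
      using Apos by (auto simp: seg_def closed_segment_same_Re closed_segment_eq_real_ivl)
    have ci: "(\<lambda>z. f p z * E z * cauchy_kernel w z) contour_integrable_on linepath (Complex X A) (Complex X (- A))"
      if "p \<le> P" for p
    proof (rule contour_integrable_continuous_linepath, fold seg_def, rule continuous_on_cauchy_kernel)
      show "w \<notin> seg"
        using seg Xw by auto
      have "seg \<subseteq> U p"
        using seg Xb[OF that] A \<delta>1 by (force simp: U_def b_def)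
      then show "continuous_on seg (\<lambda>z. f p z * E z)"
        using holomorphic_on_imp_continuous_on[OF hol[of p]]
        unfolding U_def by (intro continuous_on_mult holomorphic_on_imp_continuous_on[OF E_hol])
          (auto intro: continuous_on_subset)
    qed
    have Jsum: "J (\<lambda>z. g n z * E z) = (\<Sum>p\<le>n. J (\<lambda>z. f p z * E z))" if "n \<le> P" for n
      unfolding J_def left_edge_integral_def g_def sum_distrib_right
      by (rule contour_integral_sum) (use ci that in auto)
    have Jsplit: "J (\<lambda>z. g P z * E z) = J (\<lambda>z. g N z * E z) + (\<Sum>p\<in>{N<..P}. J (\<lambda>z. f p z * E z))"
    proof -
      have "{..P} = {..N} \<union> {N<..P}" "{..N} \<inter> {N<..P} = {}"
        using P(1) by auto
      then show ?thesis
        using P(1) by (simp add: Jsum sum.union_disjoint)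
    qed
    \<comment> \<open>The smallness exp (- \<eta> * P) of g_P cancels the weight on this edge, so
      \<open>P\<close> leaves no trace.\<close>
    have JP: "cmod (J (\<lambda>z. g P z * E z)) \<le> 2 * A * \<bar>C0\<bar>"
    proof -
      have "cmod (J (\<lambda>z. g P z * E z)) \<le> \<bar>C0\<bar> * cmod (Complex X (- A) - Complex X A)"
        unfolding J_def left_edge_integral_def
      proof (rule has_contour_integral_bound_linepath[OF has_contour_integral_integral])
        show "(\<lambda>z. g P z * E z * cauchy_kernel w z) contour_integrable_on linepath (Complex X A) (Complex X (- A))"
          unfolding g_def sum_distrib_right by (intro contour_integrable_sum ci) auto
        fix z assume "z \<in> closed_segment (Complex X A) (Complex X (- A))"
        then have z: "Re z = X" "\<bar>Im z\<bar> \<le> A"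
          using seg by (auto simp: seg_def)
        have "1 \<le> \<bar>Re (z - w)\<bar>"
          using z Xw by simp
        also have "\<dots> \<le> cmod (z - w)"
          by (rule abs_Re_le_cmod)
        finally have ker: "cmod (cauchy_kernel w z) \<le> 1"
          using Xw z by (auto simp: cauchy_kernel_def norm_divide divide_le_eq intro: order_trans[of _ 1])
        have "exp (\<beta> * (c - Re z)) = exp (\<beta> * \<delta>) * (1 + real P) powr (\<beta> * k)"
          unfolding powr_def z by (simp add: X_def algebra_simps flip: exp_add)
        then have "cmod (E z) \<le> exp (\<eta> * real P)"
          using EB[of z] P(3) by (simp add: mult.assoc) (meson exp_le_cancel_iff order_trans)
        moreover have "cmod (g P z) \<le> \<bar>C0\<bar> * exp (- \<eta> * real P)"
        proof -
          have "cmod (g P z) \<le> C0 * exp (- \<eta> * real P)"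
            unfolding g_def using z A by (intro left) (auto simp: X_def)
          also have "\<dots> \<le> \<bar>C0\<bar> * exp (- \<eta> * real P)"
            by (intro mult_right_mono) auto
          finally show ?thesis .
        qed
        ultimately have "cmod (g P z) * cmod (E z) * cmod (cauchy_kernel w z)
            \<le> (\<bar>C0\<bar> * exp (- \<eta> * real P)) * exp (\<eta> * real P) * 1"
          using ker by (intro mult_mono) auto
        also have "\<dots> = \<bar>C0\<bar>"
          by (simp add: mult.assoc flip: exp_add)
        finally show "cmod (g P z * E z * cauchy_kernel w z) \<le> \<bar>C0\<bar>"
          by (simp add: norm_mult)
      qed auto
      also have "Complex X (- A) - Complex X A = - (of_real (2 * A) * \<i>)"
        by (simp add: complex_eq_iff)
      finally show ?thesis
        using Apos by (simp add: norm_mult mult_ac)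
    qed
    \<comment> \<open>\<open>T\<close> bounds the weight on the right edge for g_N. All terms
      together are at most a constant times \<open>T\<close>, while the weight at \<open>w\<close>
      is at least T * T; the spare factor is the exponential gain.\<close>
    define T where "T = exp (\<mu> * exp \<beta> * (1 + real N))"
    have T: "T \<ge> 1"
      using \<mu> by (simp add: T_def)
    have "cmod (\<Sum>p\<in>{N<..P}. J (\<lambda>z. f p z * E z)) \<le> (\<Sum>p\<in>{N<..P}. D * exp (- \<nu>) ^ p)"
      by (auto intro!: sum_norm_le estp)
    also have "\<dots> \<le> S"
      unfolding S_def using D by (intro sum_le_suminf sD) auto
    finally have SS: "cmod (\<Sum>p\<in>{N<..P}. J (\<lambda>z. f p z * E z)) \<le> S" .
    have "cmod (2 * pi * \<i> * (g N w * E w))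
         = cmod ((2 * pi * \<i> * (g N w * E w) - J (\<lambda>z. g N z * E z)) + J (\<lambda>z. g P z * E z)
              - (\<Sum>p\<in>{N<..P}. J (\<lambda>z. f p z * E z)))"
      unfolding Jsplit by simp
    also have "\<dots> \<le> cmod (2 * pi * \<i> * (g N w * E w) - J (\<lambda>z. g N z * E z)) + cmod (J (\<lambda>z. g P z * E z))
              + cmod (\<Sum>p\<in>{N<..P}. J (\<lambda>z. f p z * E z))"
      by (meson add_right_mono norm_triangle_ineq norm_triangle_ineq4 order_trans)
    also have "\<dots> \<le> 2 * C1 * exp \<delta>1 / (A - A') + 2 * A * (C1 * T) * exp \<delta>1 / \<delta>1 + 2 * A * \<bar>C0\<bar> + S"
      using estN JP SS unfolding T_def by linarith
    also have "\<dots> \<le> 2 * C1 * exp \<delta>1 / (A - A') * T + 2 * A * C1 * exp \<delta>1 / \<delta>1 * T + 2 * A * \<bar>C0\<bar> * T + S * T"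
    proof -
      have mono: "x \<le> x * T" if "x \<ge> 0" for x
        using T that mult_left_mono[of 1 T x] by simp
      have "2 * C1 * exp \<delta>1 / (A - A') \<le> 2 * C1 * exp \<delta>1 / (A - A') * T"
        by (rule mono) (use C1 A' in auto)
      moreover have "2 * A * \<bar>C0\<bar> \<le> 2 * A * \<bar>C0\<bar> * T"
        by (rule mono) (use Apos in auto)
      moreover have "S \<le> S * T"
        by (rule mono) (rule S)
      moreover have "2 * A * (C1 * T) * exp \<delta>1 / \<delta>1 = 2 * A * C1 * exp \<delta>1 / \<delta>1 * T"
        by simp
      ultimately show ?thesis
        by linarith
    qed
    also have "\<dots> = C2 * T"
      by (simp add: C2_def algebra_simps)
    finally have "2 * pi * (cmod (g N w) * cmod (E w)) \<le> C2 * T"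
      by (simp add: norm_mult mult_ac)
    moreover have "T * T \<le> cmod (E w)"
    proof -
      have "\<beta> * \<bar>Im w\<bar> \<le> \<beta> * A'"
        using w \<beta> by (intro mult_left_mono) auto
      then have "\<gamma> \<le> cos (\<beta> * \<bar>Im w\<bar>)"
        unfolding \<gamma>_def using \<beta>(1) \<open>\<beta> * A' < pi / 2\<close> pi_gt_zero
        by (intro cos_monotone_0_pi_le) (simp, simp, linarith)
      also have "cos (\<beta> * \<bar>Im w\<bar>) = cos (\<beta> * Im w)"
        by (cases "Im w \<ge> 0") auto
      finally have cosw: "\<gamma> \<le> cos (\<beta> * Im w)" .
      have "exp (\<beta> * (c - Re w)) = exp (\<beta> * k' * ln (1 + real N)) * (exp \<beta> * exp (\<beta> * \<delta>1))"
        unfolding exp_add[symmetric] w by (simp add: algebra_simps)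
      then have "M * exp (\<beta> * (c - Re w)) * \<gamma>
          = (M * exp (\<beta> * k' * ln (1 + real N))) * exp \<beta> * (exp (\<beta> * \<delta>1) * \<gamma>)"
        by (simp only: mult_ac)
      also have "\<dots> = 2 * (\<mu> * exp \<beta> * (1 + real N))"
        unfolding MN \<delta>1(2) by simp
      finally have "2 * (\<mu> * exp \<beta> * (1 + real N)) \<le> M * exp (\<beta> * (c - Re w)) * cos (\<beta> * Im w)"
        using mult_left_mono[OF cosw, of "M * exp (\<beta> * (c - Re w))"] M by simp
      then show ?thesis
        unfolding cE T_def exp_add[symmetric] by simp
    qed
    ultimately have "2 * pi * (cmod (g N w) * (T * T)) \<le> C2 * T"
      by (smt (verit, best) mult_left_mono norm_ge_zero pi_gt_zero)
    then have "2 * pi * cmod (g N w) * T \<le> C2"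
      using T by (simp add: mult.assoc[symmetric])
    moreover have "1 * (cmod (g N w) * T) \<le> 2 * pi * (cmod (g N w) * T)"
      using T pi_gt3 by (intro mult_right_mono) auto
    ultimately have "cmod (g N w) * T \<le> C2"
      by (simp add: mult.assoc)
    moreover have "exp (\<mu> * exp \<beta> * real N) \<le> T"
      using \<mu> by (simp add: T_def)
    ultimately have "cmod (g N w) * exp (\<mu> * exp \<beta> * real N) \<le> C2"
      by (meson mult_left_mono norm_ge_zero order_trans)
    then have "cmod (g N w) * exp (\<mu> * exp \<beta> * real N) * exp (- (\<mu> * exp \<beta> * real N))
                 \<le> C2 * exp (- (\<mu> * exp \<beta> * real N))"
      by (intro mult_right_mono) auto
    then show ?thesis
      by (simp add: mult.assoc g_def flip: exp_add)
  qed
  moreover have "\<mu> * exp \<beta> > 0"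
    using \<mu> by simp
  ultimately show ?thesis
    unfolding exp_small_def using A' \<delta>1 by (metis add_pos_pos zero_less_one)
qed

section \<open>The coefficients of a multisummable function\<close>

lemma summable_of_ennreal_suminf_weighted:
  fixes X :: "nat \<Rightarrow> ennreal"
  assumes fin: "(\<Sum>p. X p * ennreal (r ^ p)) < \<infinity>" and r: "r > 0"
  shows "X p < \<infinity>" and "summable (\<lambda>p. enn2real (X p) * r ^ p)"
proof -
  have X: "X p < \<infinity>" for p
  proof (rule ccontr)
    assume "\<not> X p < \<infinity>"
    then have "X p = top"
      by (metis infinity_ennreal_def less_top)
    then have "X p * ennreal (r ^ p) = top"
      using r by (simp add: ennreal_top_mult)
    then show False
      using ennreal_suminf_lessD[OF fin, of p] by simp
  qed
  then show "X p < \<infinity>" .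
  have "X p * ennreal (r ^ p) = ennreal (enn2real (X p) * r ^ p)" for p
    using X[of p] r by (simp add: ennreal_mult less_top)
  then have "(\<Sum>p. ennreal (enn2real (X p) * r ^ p)) \<noteq> top"
    using fin by simp
  then show "summable (\<lambda>p. enn2real (X p) * r ^ p)"
  proof (rule summable_suminf_not_top[rotated])
    show "0 \<le> enn2real (X p) * r ^ p" for p
      using r by simp
  qed
qed

lemma norm_log_monomial_le:
  assumes "0 \<le> \<alpha>" "0 < s" "w \<in> half_plane (ln s)"
  shows "cmod (log_monomial \<alpha> w) \<le> s powr \<alpha>"
proof (cases w)
  case (Fin z)
  then have "\<alpha> * Re z \<le> \<alpha> * ln s"
    using assms by (intro mult_left_mono) (auto simp: half_plane_def)
  then show ?thesis
    using Fin assms by (simp add: powr_def)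
qed (use assms in auto)

lemma cmod_infsum_le:
  fixes g :: "real \<Rightarrow> complex"
  assumes "\<And>S. finite S \<Longrightarrow> S \<subseteq> X \<Longrightarrow> (\<Sum>\<alpha>\<in>S. cmod (g \<alpha>)) \<le> B"
  shows "g summable_on X" and "cmod (infsum g X) \<le> B"
proof -
  have abs: "(\<lambda>\<alpha>. cmod (g \<alpha>)) summable_on X"
    unfolding abs_summable_iff_bdd_above using assms by (intro bdd_aboveI2[where M = B]) auto
  then show "g summable_on X"
    by (rule abs_summable_summable)
  have "cmod (infsum g X) \<le> (\<Sum>\<^sub>\<infinity>\<alpha>\<in>X. cmod (g \<alpha>))"
    by (rule norm_infsum_bound[OF abs])
  also have "\<dots> \<le> B"
    by (rule infsum_le_finite_sums[OF abs]) (use assms in auto)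
  finally show "cmod (infsum g X) \<le> B" .
qed

section \<open>Geometry of the domains and radii\<close>

locale multisum_setting =
  fixes K \<Delta> :: "real set" and R r \<theta> :: real
  assumes K: "K \<subseteq> {0..}" "K \<noteq> {}" "finite K"
    and R: "R > 0" and r: "r > 1" and \<theta>: "\<theta> > pi / 2"
    and \<Delta>: "\<Delta> \<subseteq> {0..}" "natural_set \<Delta>"
begin

definition kmax :: real where "kmax = Max K"

abbreviation \<rho> :: "nat \<Rightarrow> real" where "\<rho> p \<equiv> rho_tau K R p"

lemma \<theta>_pos: "\<theta> > 0"
  using \<theta> pi_gt_zero by linarith

lemma kmax: "kmax \<in> K" "kmax \<ge> 0" "k \<in> K \<Longrightarrow> k \<le> kmax"
proof -
  show "kmax \<in> K"
    unfolding kmax_def using K by (intro Max_in)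
  then show "kmax \<ge> 0"
    using K by auto
  show "k \<in> K \<Longrightarrow> k \<le> kmax"
    unfolding kmax_def using K by (intro Max_ge)
qed

lemma ln_rho: "ln (rho R k p) = ln R - k * ln (1 + real p)"
  using R by (simp add: rho_def ln_div)

lemma rho_pos: "rho R k p > 0"
  using R by (simp add: rho_def)

lemma rho_tau_eq: "\<rho> p = rho R kmax p"
  unfolding rho_tau_def
proof (rule Min_eqI)
  fix y assume "y \<in> (\<lambda>k. rho R k p) ` K"
  then obtain k where k: "k \<in> K" "y = rho R k p"
    by auto
  have "k * ln (1 + real p) \<le> kmax * ln (1 + real p)"
    using kmax(3)[OF k(1)] by (intro mult_right_mono) auto
  then have "ln (rho R kmax p) \<le> ln (rho R k p)"
    by (simp add: ln_rho)
  then show "rho R kmax p \<le> y"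
    using rho_pos k by simp
qed (use K kmax in auto)

lemma rho_tau_pos: "\<rho> p > 0"
  by (simp add: rho_tau_eq rho_pos)

lemma ln_rho_tau: "ln (\<rho> p) = ln R - kmax * ln (1 + real p)"
  by (simp add: rho_tau_eq ln_rho)

lemma ln_rho_tau_antimono: "p \<le> p' \<Longrightarrow> ln (\<rho> p') \<le> ln (\<rho> p)"
  using kmax by (auto simp: ln_rho_tau intro!: mult_left_mono)

lemma finite_Delta: "finite (\<Delta> \<inter> {..<x})"
  using \<Delta> by (auto simp: natural_set_def)

text \<open>Levels up to k' are handled by their half-planes, levels from \<open>k\<close> on by
  their strips, and \<open>gap\<close> excludes others. This yields the half-strip on which the
  Watson step from \<open>k\<close> to k' operates; k' may be 0 without lying in
  \<open>K\<close>.\<close>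

lemma mem_S_tau_p_level:
  assumes "0 \<le> k'" and gap: "\<And>\<kappa>. \<kappa> \<in> K \<Longrightarrow> \<kappa> \<le> k' \<or> k \<le> \<kappa>"
    and z: "Re z < ln R - k' * ln (1 + real p)" "\<bar>Im z\<bar> < \<theta> * k"
  shows "Fin z \<in> S_tau_p K R \<theta> p"
proof -
  have "Fin z \<in> strip (ln R) (\<theta> * \<kappa>) \<union> half_plane (ln (rho R \<kappa> p))" if \<kappa>: "\<kappa> \<in> K" for \<kappa>
  proof (cases "\<kappa> \<le> k'")
    case True
    then have "\<kappa> * ln (1 + real p) \<le> k' * ln (1 + real p)"
      by (intro mult_right_mono) auto
    then show ?thesis
      using z by (auto simp: half_plane_def ln_rho)
  next
    case False
    then have "k \<le> \<kappa>"
      using gap[OF \<kappa>] by auto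
    then have "\<theta> * k \<le> \<theta> * \<kappa>"
      using \<theta>_pos by (intro mult_left_mono) auto
    moreover have "k' * ln (1 + real p) \<ge> 0"
      using assms by simp
    ultimately show ?thesis
      using z by (auto simp: strip_def)
  qed
  then show ?thesis
    unfolding S_tau_p_def strip_nbhd_def using closure_subset by blast
qed

lemma S_tau_subset: "S_tau K R \<theta> \<subseteq> S_tau_p K R \<theta> p"
proof (cases "K = {0}")
  case True
  then show ?thesis
    using closure_subset by (auto simp: S_tau_def S_tau_p_def strip_nbhd_0)
next
  case False
  then obtain k0 where k0: "k0 \<in> K - {0}"
    using K by auto
  have "w \<in> strip_nbhd R \<theta> k p" if w: "w \<in> S_tau K R \<theta>" and k: "k \<in> K" for w k
  proof -
    have w': "w \<in> strip (ln R) (\<theta> * k)" if "k \<in> K - {0}" for k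
      using w that False by (auto simp: S_tau_def)
    have "w \<in> strip (ln R) (\<theta> * k) \<union> half_plane (ln (rho R k p))"
    \<comment> \<open>At level 0 the strip is empty apart from \<open>MInf\<close>, so membership
      has to come from the half-plane; it is read off the nonzero level \<open>k0\<close>.\<close>
    proof (cases "k = 0")
      case True
      then show ?thesis
        using w'[OF k0] by (auto simp: ln_rho strip_def half_plane_def)
    qed (use k w' in auto)
    then show ?thesis
      unfolding strip_nbhd_def by (rule subsetD[OF closure_subset])
  qed
  then show ?thesis
    by (auto simp: S_tau_p_def)
qed

lemma vimage_S_tau:
  shows "open (Fin -` S_tau K R \<theta>)" and "convex (Fin -` S_tau K R \<theta>)"
    and "x < ln R \<Longrightarrow> Fin (of_real x) \<in> S_tau K R \<theta>" and "MInf \<in> S_tau K R \<theta>"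
proof -
  have strip: "Fin -` strip x \<phi> = {z. Re z < x} \<inter> ({z. Im z < \<phi>} \<inter> {z. Im z > - \<phi>})" for x \<phi>
    by (auto simp: strip_def)
  have half: "Fin -` half_plane x = {z. Re z < x}" for x
    by (auto simp: half_plane_def)
  have vim: "Fin -` S_tau K R \<theta> = (if K = {0} then {z. Re z < ln R} else
      (\<Inter>k\<in>K - {0}. {z. Re z < ln R} \<inter> ({z. Im z < \<theta> * k} \<inter> {z. Im z > - (\<theta> * k)})))"
    by (simp add: S_tau_def half vimage_INT strip)
  show "open (Fin -` S_tau K R \<theta>)"
    unfolding vim using K
    by (auto intro!: open_INT open_Int open_halfspace_Re_lt open_halfspace_Im_lt open_halfspace_Im_gt)
  show "convex (Fin -` S_tau K R \<theta>)"
    unfolding vim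
    by (auto intro!: convex_INT convex_Int convex_halfspace_Re_lt convex_halfspace_Im_lt convex_halfspace_Im_gt)
  have "0 < \<theta> * k" if "k \<in> K - {0}" for k
  proof -
    have "k > 0"
      using that K by force
    then show ?thesis
      using \<theta>_pos by simp
  qed
  then show "x < ln R \<Longrightarrow> Fin (of_real x) \<in> S_tau K R \<theta>"
    by (auto simp: S_tau_def half_plane_def strip_def)
  show "MInf \<in> S_tau K R \<theta>"
    by (auto simp: S_tau_def half_plane_def strip_def)
qed

end

text \<open>A representation detached from its sum, with one real bound \<open>n p\<close> for both
  the series and the function. In terms of finite sums and real bounds the conditions pass easily to
  differences of two representations.\<close>

locale multisum_data = multisum_setting +
  fixes f :: "nat \<Rightarrow> logplane \<Rightarrow> complex" and a :: "nat \<Rightarrow> real \<Rightarrow> complex" and n :: "nat \<Rightarrow> real"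
  assumes hol: "open V \<Longrightarrow> Fin ` V \<subseteq> S_tau_p K R \<theta> p \<Longrightarrow> (\<lambda>z. f p (Fin z)) holomorphic_on V"
    and bd: "w \<in> S_tau_p K R \<theta> p \<Longrightarrow> cmod (f p w) \<le> n p"
    and supp: "a p \<alpha> \<noteq> 0 \<Longrightarrow> \<alpha> \<in> \<Delta>"
    and coef: "finite S \<Longrightarrow> S \<subseteq> {0..} \<Longrightarrow> (\<Sum>\<alpha>\<in>S. cmod (a p \<alpha>) * \<rho> p powr \<alpha>) \<le> n p"
    and ser: "w \<in> half_plane (ln (\<rho> p)) \<Longrightarrow> f p w = log_sum (a p) w"
    and summ: "summable (\<lambda>p. n p * r ^ p)"
begin

section \<open>Growth of the coefficients and remainder of the expansion\<close>

lemma n_nonneg: "n p \<ge> 0"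
  using coef[of "{}" p] by simp

definition total_norm :: real where "total_norm = (\<Sum>p. n p * r ^ p)"

text \<open>Supplies the geometric bound, with ratio 1 / r, that the Watson step asks for.\<close>

lemma n_le: "n p \<le> total_norm * (1 / r) ^ p"
proof -
  have "n p * r ^ p = (\<Sum>i\<in>{p}. n i * r ^ i)"
    by simp
  also have "\<dots> \<le> total_norm"
    unfolding total_norm_def using n_nonneg r by (intro sum_le_suminf summ) auto
  finally show ?thesis
    using r by (simp add: field_simps)
qed

lemma total_norm_nonneg: "total_norm \<ge> 0"
  unfolding total_norm_def using n_nonneg r by (intro suminf_nonneg summ) auto

lemma log_sum_summable:
  assumes "w \<in> half_plane (ln (\<rho> p))"
  shows "(\<lambda>\<alpha>. a p \<alpha> * log_monomial \<alpha> w) summable_on {0..}"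
proof (rule cmod_infsum_le(1))
  fix S :: "real set" assume S: "finite S" "S \<subseteq> {0..}"
  then have "(\<Sum>\<alpha>\<in>S. cmod (a p \<alpha> * log_monomial \<alpha> w)) \<le> (\<Sum>\<alpha>\<in>S. cmod (a p \<alpha>) * \<rho> p powr \<alpha>)"
    unfolding norm_mult using assms rho_tau_pos
    by (intro sum_mono mult_left_mono norm_log_monomial_le) auto
  also have "\<dots> \<le> n p"
    using S by (rule coef)
  finally show "(\<Sum>\<alpha>\<in>S. cmod (a p \<alpha> * log_monomial \<alpha> w)) \<le> n p" .
qed

lemma coef_le:
  assumes "\<alpha> \<in> \<Delta>"
  shows "cmod (a p \<alpha>) \<le> n p * exp (- \<alpha> * ln (\<rho> p))"
proof -
  have "cmod (a p \<alpha>) * exp (\<alpha> * ln (\<rho> p)) \<le> n p"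
    using coef[of "{\<alpha>}" p] assms \<Delta> rho_tau_pos[of p] by (auto simp: powr_def)
  then show ?thesis
    by (simp add: exp_minus field_simps)
qed

text \<open>For fixed \<alpha> the factor is a constant times (1 + p) powr (\<alpha> * kmax),
  polynomial in \<open>p\<close> and therefore absorbed by r ^ p.\<close>

lemma summable_n_rho: "summable (\<lambda>p. n p * exp (- \<alpha> * ln (\<rho> p)))"
proof -
  define e where "e = \<alpha> * kmax"
  have "(\<lambda>p. (1 + real p) powr e / r ^ p) \<longlonglongrightarrow> 0"
    using r by real_asymp
  then have "\<forall>\<^sub>F p in sequentially. (1 + real p) powr e / r ^ p < 1"
    by (rule order_tendstoD) simp
  then have "\<forall>\<^sub>F p in sequentially. norm (n p * exp (- \<alpha> * ln (\<rho> p))) \<le> exp (- \<alpha> * ln R) * (n p * r ^ p)"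
  proof eventually_elim
    case (elim p)
    then have "(1 + real p) powr e \<le> r ^ p"
      using r by (simp add: field_simps)
    moreover have "exp (- \<alpha> * ln (\<rho> p)) = exp (- \<alpha> * ln R) * (1 + real p) powr e"
      by (simp add: ln_rho_tau powr_def e_def algebra_simps flip: exp_add)
    ultimately have "norm (n p * exp (- \<alpha> * ln (\<rho> p))) \<le> n p * (exp (- \<alpha> * ln R) * r ^ p)"
      using n_nonneg[of p] by (auto simp: abs_mult intro!: mult_left_mono)
    then show ?case
      by (simp add: mult.left_commute)
  qed
  then show ?thesis
    by (rule summable_comparison_test_ev) (intro summable_mult summ)
qed

lemma summable_coef: "summable (\<lambda>p. cmod (a p \<alpha>))"
proof (cases "\<alpha> \<in> \<Delta>")
  case True
  show ?thesis
    by (rule summable_comparison_test_ev[OF _ summable_n_rho[of \<alpha>]]) (use coef_le[OF True] in auto)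
next
  case False
  then have "a p \<alpha> = 0" for p
    using supp by blast
  then show ?thesis
    by simp
qed

text \<open>Relative to its share of the norm at radius \<rho> p, the exponent \<alpha> carries the
  factor exp (\<alpha> * (Re z - ln (\<rho> p))), which for \<alpha> \<ge> \<alpha>1 is largest at
  \<alpha>1. The cut \<alpha>1 need not lie in \<Delta>, so it can also be made to grow with
  \<open>N\<close>.\<close>

lemma expansion_remainder:
  assumes z: "Re z < ln (\<rho> p)" and "0 \<le> \<alpha>1"
  shows "cmod (f p (Fin z) - (\<Sum>\<alpha>\<in>\<Delta> \<inter> {..<\<alpha>1}. a p \<alpha> * exp (of_real \<alpha> * z)))
           \<le> n p * exp (\<alpha>1 * (Re z - ln (\<rho> p)))"
proof -
  define g where "g \<alpha> = a p \<alpha> * exp (of_real \<alpha> * z)" for \<alpha>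
  have bound: "(\<Sum>\<alpha>\<in>S. cmod (g \<alpha>)) \<le> n p * exp (\<alpha>1 * (Re z - ln (\<rho> p)))"
    if S: "finite S" "S \<subseteq> {\<alpha>1..}" for S
  proof -
    have "cmod (g \<alpha>) \<le> cmod (a p \<alpha>) * \<rho> p powr \<alpha> * exp (\<alpha>1 * (Re z - ln (\<rho> p)))" if "\<alpha> \<in> S" for \<alpha>
    proof -
      have "(\<alpha> - \<alpha>1) * (Re z - ln (\<rho> p)) \<le> 0"
        using that S z by (intro mult_nonneg_nonpos) auto
      then have "exp (\<alpha> * Re z) \<le> exp (\<alpha> * ln (\<rho> p) + \<alpha>1 * (Re z - ln (\<rho> p)))"
        by (simp add: algebra_simps)
      also have "\<dots> = \<rho> p powr \<alpha> * exp (\<alpha>1 * (Re z - ln (\<rho> p)))"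
        using rho_tau_pos[of p] by (simp add: exp_add powr_def)
      finally show ?thesis
        by (auto simp: g_def norm_mult mult.assoc intro!: mult_left_mono)
    qed
    then have "(\<Sum>\<alpha>\<in>S. cmod (g \<alpha>))
        \<le> (\<Sum>\<alpha>\<in>S. cmod (a p \<alpha>) * \<rho> p powr \<alpha>) * exp (\<alpha>1 * (Re z - ln (\<rho> p)))"
      unfolding sum_distrib_right by (auto intro!: sum_mono)
    also have "\<dots> \<le> n p * exp (\<alpha>1 * (Re z - ln (\<rho> p)))"
      using S assms by (intro mult_right_mono coef) auto
    finally show ?thesis .
  qed
  have w: "Fin z \<in> half_plane (ln (\<rho> p))"
    using z by (simp add: half_plane_def)
  have "g summable_on {0..<\<alpha>1}"
    using log_sum_summable[OF w] unfolding g_def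
    by (auto intro: summable_on_subset_banach)
  then have "infsum g ({0..<\<alpha>1} \<union> {\<alpha>1..}) = infsum g {0..<\<alpha>1} + infsum g {\<alpha>1..}"
    by (intro infsum_Un_disjoint) (auto intro: cmod_infsum_le(1) bound)
  moreover have "infsum g {0..<\<alpha>1} = infsum g (\<Delta> \<inter> {..<\<alpha>1})"
    using supp \<Delta> by (intro infsum_cong_neutral) (auto simp: g_def)
  moreover have "{0..<\<alpha>1} \<union> {\<alpha>1..} = {0..}"
    using assms by auto
  moreover have "f p (Fin z) = infsum g {0..}"
    using ser[OF w] by (simp add: log_sum_def g_def [abs_def])
  ultimately have "f p (Fin z) - (\<Sum>\<alpha>\<in>\<Delta> \<inter> {..<\<alpha>1}. g \<alpha>) = infsum g {\<alpha>1..}"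
    using finite_Delta by simp
  moreover have "cmod (infsum g {\<alpha>1..}) \<le> n p * exp (\<alpha>1 * (Re z - ln (\<rho> p)))"
    by (auto intro: cmod_infsum_le(2) bound)
  ultimately show ?thesis
    by (simp add: g_def)
qed

text \<open>The term of index \<open>p\<close> in the Tannery sum is bounded by its series if \<open>x < ln (\<rho> p)\<close>; otherwise \<open>f p\<close>
  is bounded by \<open>n p\<close> and \<open>exp (- \<alpha> * x)\<close> by \<open>\<rho> p powr (- \<alpha>)\<close>.\<close>

lemma coef_sums_zero:
  assumes zero: "\<And>w. w \<in> S_tau K R \<theta> \<Longrightarrow> (\<lambda>p. f p w) sums 0"
  shows "(\<lambda>p. a p \<alpha>) sums 0"
proof -
  have "(\<lambda>p. a p \<alpha>) sums 0" if "\<alpha> \<in> \<Delta>" for \<alpha>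
    using that
  \<comment> \<open>Finitely many exponents lie below \<alpha> since \<Delta> is natural. Their
    coefficient series must be known to sum to 0 before the terms \<open>h p x\<close> below can sum
    to 0.\<close>
  proof (induction "card (\<Delta> \<inter> {..<\<alpha>})" arbitrary: \<alpha> rule: less_induct)
    case less
    define D where "D = \<Delta> \<inter> {..<\<alpha>}"
    have finD: "finite D"
      using finite_Delta by (simp add: D_def)
    have IH: "(\<lambda>p. a p \<beta>) sums 0" if "\<beta> \<in> D" for \<beta>
    proof (rule less.hyps)
      have "\<Delta> \<inter> {..<\<beta>} \<subset> D"
        using that by (auto simp: D_def)
      then show "card (\<Delta> \<inter> {..<\<beta>}) < card (\<Delta> \<inter> {..<\<alpha>})"
        using psubset_card_mono[OF finD] by (simp add: D_def)
    qed (use that in \<open>auto simp: D_def\<close>)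
    have \<alpha>0: "\<alpha> \<ge> 0"
      using less.prems \<Delta> by auto
    \<comment> \<open>The next exponent in \<Delta>, or \<alpha> + 1 if none comes earlier; cutting
      there isolates the term at \<alpha>.\<close>
    define \<alpha>1 where "\<alpha>1 = Min (insert (\<alpha> + 1) (\<Delta> \<inter> {\<alpha><..<\<alpha> + 1}))"
    have fin1: "finite (\<Delta> \<inter> {\<alpha><..<\<alpha> + 1})"
      by (rule finite_subset[OF _ finite_Delta[of "\<alpha> + 1"]]) auto
    have \<alpha>1: "\<alpha> < \<alpha>1" "\<alpha>1 \<le> \<alpha> + 1"
      using fin1 by (auto simp: \<alpha>1_def)
    have gap: "\<Delta> \<inter> {..<\<alpha>1} = insert \<alpha> D"
    proof -
      have "\<beta> \<le> \<alpha>" if "\<beta> \<in> \<Delta>" "\<beta> < \<alpha>1" for \<beta>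
      proof (rule ccontr)
        assume "\<not> \<beta> \<le> \<alpha>"
        then have "\<beta> \<in> \<Delta> \<inter> {\<alpha><..<\<alpha> + 1}"
          using that \<alpha>1 by auto
        then have "\<alpha>1 \<le> \<beta>"
          unfolding \<alpha>1_def using fin1 by (intro Min_le) auto
        then show False
          using that by simp
      qed
      then show ?thesis
        using less.prems \<alpha>1 by (force simp: D_def)
    qed
    define h where "h p x = of_real (exp (- \<alpha> * x)) *
        (f p (Fin (of_real x)) - (\<Sum>\<beta>\<in>D. a p \<beta> * exp (of_real \<beta> * of_real x)))" for p and x :: real
    \<comment> \<open>The factor 2 is for x \<ge> ln (\<rho> p), where \<open>f p\<close> and the
      subtracted terms are bounded separately.\<close>
    define M where "M p = 2 * (n p * exp (- \<alpha> * ln (\<rho> p)))" for p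
    have lim: "(h p \<longlongrightarrow> a p \<alpha>) at_bot" for p
    proof -
      have "norm (h p x - a p \<alpha>) \<le> n p * exp (\<alpha>1 * (x - ln (\<rho> p)) - \<alpha> * x)" if x: "x < ln (\<rho> p)" for x
      proof -
        have "exp (- \<alpha> * x) * exp (of_real \<alpha> * of_real x :: complex) = 1"
          by (simp flip: exp_of_real exp_add)
        then have "h p x - a p \<alpha> = of_real (exp (- \<alpha> * x)) * (f p (Fin (of_real x)) -
            (\<Sum>\<beta>\<in>\<Delta> \<inter> {..<\<alpha>1}. a p \<beta> * exp (of_real \<beta> * of_real x)))"
          unfolding gap h_def using finD by (simp add: D_def algebra_simps)
        then have "norm (h p x - a p \<alpha>) \<le> exp (- \<alpha> * x) * (n p * exp (\<alpha>1 * (x - ln (\<rho> p))))"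
          using expansion_remainder[of "of_real x" p \<alpha>1] x \<alpha>0 \<alpha>1 by (simp add: norm_mult)
        also have "\<dots> = n p * exp (\<alpha>1 * (x - ln (\<rho> p)) - \<alpha> * x)"
          by (simp add: mult.left_commute flip: exp_add)
        finally show ?thesis .
      qed
      then have "\<forall>\<^sub>F x in at_bot. norm (h p x - a p \<alpha>) \<le> n p * exp (\<alpha>1 * (x - ln (\<rho> p)) - \<alpha> * x)"
        using eventually_at_bot_dense by blast
      moreover have "((\<lambda>x. n p * exp (\<alpha>1 * (x - ln (\<rho> p)) - \<alpha> * x)) \<longlongrightarrow> 0) at_bot"
      proof -
        define d where "d = \<alpha>1 - \<alpha>"
        have d: "d > 0"
          using \<alpha>1 by (simp add: d_def)
        have "((\<lambda>x. n p * exp (- \<alpha>1 * ln (\<rho> p)) * exp (d * x)) \<longlongrightarrow> 0) at_bot"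
          using d by real_asymp
        then show ?thesis
          by (simp add: d_def algebra_simps flip: exp_add)
      qed
      ultimately have "((\<lambda>x. h p x - a p \<alpha>) \<longlongrightarrow> 0) at_bot"
        by (rule Lim_null_comparison)
      then show ?thesis
        by (simp add: LIM_zero_iff)
    qed
    have dom: "norm (h p x) \<le> M p" if x: "x < ln R" for p x
    proof (cases "x < ln (\<rho> p)")
      case True
      have "norm (h p x) \<le> exp (- \<alpha> * x) * (n p * exp (\<alpha> * (x - ln (\<rho> p))))"
        using expansion_remainder[of "of_real x" p \<alpha>] True \<alpha>0 by (simp add: h_def norm_mult D_def)
      also have "\<dots> = n p * exp (- \<alpha> * ln (\<rho> p))"
        by (simp add: algebra_simps flip: exp_add)
      finally have "norm (h p x) \<le> n p * exp (- \<alpha> * ln (\<rho> p))" .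
      moreover have "0 \<le> n p * exp (- \<alpha> * ln (\<rho> p))"
        using n_nonneg[of p] by simp
      ultimately show ?thesis
        unfolding M_def by linarith
    next
      case False
      have "exp (- \<alpha> * x) * cmod (f p (Fin (of_real x))) \<le> exp (- \<alpha> * ln (\<rho> p)) * n p"
        using False \<alpha>0 vimage_S_tau(3)[OF x] S_tau_subset
        by (intro mult_mono bd) (auto intro: mult_left_mono)
      moreover have "exp (- \<alpha> * x) * cmod (\<Sum>\<beta>\<in>D. a p \<beta> * exp (of_real \<beta> * of_real x))
           \<le> exp (- \<alpha> * ln (\<rho> p)) * n p"
      proof -
        have "exp (- \<alpha> * x) * cmod (\<Sum>\<beta>\<in>D. a p \<beta> * exp (of_real \<beta> * of_real x))
            \<le> exp (- \<alpha> * x) * (\<Sum>\<beta>\<in>D. cmod (a p \<beta>) * exp (\<beta> * x))"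
          by (intro mult_left_mono sum_norm_le) (auto simp: norm_mult)
        also have "\<dots> \<le> (\<Sum>\<beta>\<in>D. exp (- \<alpha> * ln (\<rho> p)) * (cmod (a p \<beta>) * \<rho> p powr \<beta>))"
          unfolding sum_distrib_left
        proof (rule sum_mono)
          fix \<beta> assume "\<beta> \<in> D"
          \<comment> \<open>exp (\<beta> * x) alone may grow with \<open>x\<close>, but \<beta> -
            \<alpha> is negative on \<open>D\<close>, so the product is largest at the endpoint ln
            (\<rho> p).\<close>
          then have "(\<alpha> - \<beta>) * ln (\<rho> p) \<le> (\<alpha> - \<beta>) * x"
            using False by (intro mult_left_mono) (auto simp: D_def)
          then have "exp (- \<alpha> * x) * exp (\<beta> * x) \<le> exp (- \<alpha> * ln (\<rho> p)) * exp (\<beta> * ln (\<rho> p))"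
            by (simp add: algebra_simps flip: exp_add)
          then have "cmod (a p \<beta>) * (exp (- \<alpha> * x) * exp (\<beta> * x))
              \<le> cmod (a p \<beta>) * (exp (- \<alpha> * ln (\<rho> p)) * exp (\<beta> * ln (\<rho> p)))"
            by (rule mult_left_mono) simp
          then show "exp (- \<alpha> * x) * (cmod (a p \<beta>) * exp (\<beta> * x))
               \<le> exp (- \<alpha> * ln (\<rho> p)) * (cmod (a p \<beta>) * \<rho> p powr \<beta>)"
            using rho_tau_pos[of p] by (simp add: powr_def mult_ac)
        qed
        also have "\<dots> \<le> exp (- \<alpha> * ln (\<rho> p)) * n p"
          unfolding sum_distrib_left[symmetric] using finD \<Delta>
          by (intro mult_left_mono coef) (auto simp: D_def)
        finally show ?thesis .
      qed
      moreover have "norm (h p x) \<le> exp (- \<alpha> * x) * cmod (f p (Fin (of_real x)))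
          + exp (- \<alpha> * x) * cmod (\<Sum>\<beta>\<in>D. a p \<beta> * exp (of_real \<beta> * of_real x))"
        unfolding h_def norm_mult distrib_left[symmetric]
        by (simp add: norm_triangle_ineq4)
      ultimately show ?thesis
        by (simp add: M_def mult.commute)
    qed
    have h0: "(\<lambda>p. h p x) sums 0" if x: "x < ln R" for x
    proof -
      have "(\<lambda>p. \<Sum>\<beta>\<in>D. a p \<beta> * exp (of_real \<beta> * of_real x)) sums (\<Sum>\<beta>\<in>D. 0 * exp (of_real \<beta> * of_real x))"
        by (intro sums_sum sums_mult2 IH)
      then have "(\<lambda>p. h p x) sums (of_real (exp (- \<alpha> * x)) * (0 - 0))"
        unfolding h_def by (intro sums_mult sums_diff zero vimage_S_tau(3)[OF x]) simp
      then show ?thesis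
        by simp
    qed
    have "((\<lambda>x. \<Sum>p. h p x) \<longlongrightarrow> (\<Sum>p. a p \<alpha>)) at_bot"
    proof -
      have "\<forall>\<^sub>F (p, x) in at_top \<times>\<^sub>F at_bot. norm (h p x) \<le> M p"
        unfolding eventually_prod_filter case_prod_conv using dom
        by (intro exI[of _ "\<lambda>_. True"] exI[of _ "\<lambda>x. x < ln R"]) (auto simp: eventually_at_bot_dense)
      moreover have "summable M"
        unfolding M_def by (intro summable_mult summable_n_rho)
      ultimately show ?thesis
        using tannerys_theorem[of h "\<lambda>p. a p \<alpha>" at_bot M] lim by auto
    qed
    moreover have "\<forall>\<^sub>F x in at_bot. (\<Sum>p. h p x) = 0"
      unfolding eventually_at_bot_dense using sums_unique[OF h0, symmetric]
      by (intro exI[of _ "ln R"]) simp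
    then have "((\<lambda>x. \<Sum>p. h p x) \<longlongrightarrow> 0) at_bot"
      by (rule tendsto_eventually)
    ultimately have "(\<Sum>p. a p \<alpha>) = 0"
      by (intro tendsto_unique) auto
    then show ?case
      using summable_sums[OF summable_norm_cancel[OF summable_coef]] by metis
  qed
  moreover have "(\<lambda>p. a p \<alpha>) sums 0" if "\<alpha> \<notin> \<Delta>"
  proof -
    have "a p \<alpha> = 0" for p
      using supp that by blast
    then show ?thesis
      by simp
  qed
  ultimately show ?thesis
    by blast
qed

end

section \<open>Vanishing coefficients\<close>

context multisum_data
begin

text \<open>The tail of the coefficients after \<open>N\<close> is small because
  \<open>(\<rho> N / \<rho> q) powr \<alpha> \<le> exp (kmax * \<alpha> * (q - N) / (1 + N))\<close> for \<open>q > N\<close>, which is at most \<open>r ^ (q - N)\<close>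
  as long as \<open>kmax * \<alpha> \<le> N * ln r\<close>.\<close>

lemma coef_partial_sum_le:
  assumes zero: "\<And>\<alpha>. (\<lambda>p. a p \<alpha>) sums 0" and "finite D" "D \<subseteq> {0..}"
    and rr: "\<And>\<alpha>. \<alpha> \<in> D \<Longrightarrow> kmax * \<alpha> \<le> ln r * real N"
  shows "(\<Sum>\<alpha>\<in>D. cmod (\<Sum>p\<le>N. a p \<alpha>) * \<rho> N powr \<alpha>) \<le> total_norm * exp (- ln r * real N)"
proof -
  \<comment> \<open>With q = p + Suc N this is n q * r ^ (q - N): passing from \<rho> q to \<rho> N
    costs r ^ (q - N), and summing n q * r ^ q leaves the factor r ^ (- N).\<close>
  define T where "T = (\<lambda>p. n (p + Suc N) * r ^ (p + Suc N) * exp (- ln r * real N))"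
  have rp: "r ^ p = exp (ln r * real p)" for p
    using r by (simp add: mult.commute exp_of_nat_mult)
  have summ_T: "summable T"
    unfolding T_def by (intro summable_mult2 summable_ignore_initial_segment summ)
  have suminf_T: "suminf T \<le> total_norm * exp (- ln r * real N)"
  proof -
    have "(\<Sum>p. n (p + Suc N) * r ^ (p + Suc N)) = total_norm - (\<Sum>p<Suc N. n p * r ^ p)"
      unfolding total_norm_def using suminf_minus_initial_segment[OF summ, of "Suc N"] by simp
    also have "\<dots> \<le> total_norm"
    proof -
      have "(\<Sum>p<Suc N. n p * r ^ p) \<ge> 0"
        using n_nonneg r by (intro sum_nonneg) auto
      then show ?thesis
        by linarith
    qed
    finally have "(\<Sum>p. n (p + Suc N) * r ^ (p + Suc N)) \<le> total_norm" .
    moreover have "suminf T = (\<Sum>p. n (p + Suc N) * r ^ (p + Suc N)) * exp (- ln r * real N)"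
      unfolding T_def by (intro suminf_mult2[symmetric] summable_ignore_initial_segment summ)
    ultimately show ?thesis
      by simp
  qed
  have tail: "cmod (\<Sum>p\<le>N. a p \<alpha>) \<le> (\<Sum>p. cmod (a (p + Suc N) \<alpha>))" for \<alpha>
  proof -
    have "(\<Sum>p. a (p + Suc N) \<alpha>) = - (\<Sum>p\<le>N. a p \<alpha>)"
      using suminf_minus_initial_segment[OF sums_summable[OF zero[of \<alpha>]], of "Suc N"] sums_unique[OF zero[of \<alpha>]]
      by (simp add: lessThan_Suc_atMost)
    then have "cmod (\<Sum>p\<le>N. a p \<alpha>) = cmod (\<Sum>p. a (p + Suc N) \<alpha>)"
      by simp
    also have "\<dots> \<le> (\<Sum>p. cmod (a (p + Suc N) \<alpha>))"
      by (intro summable_norm summable_ignore_initial_segment[OF summable_coef])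
    finally show ?thesis .
  qed
  have term_le: "(\<Sum>\<alpha>\<in>D. cmod (a (p + Suc N) \<alpha>) * \<rho> N powr \<alpha>) \<le> T p" for p
  proof -
    define q where "q = p + Suc N"
    have "cmod (a q \<alpha>) * \<rho> N powr \<alpha> \<le> cmod (a q \<alpha>) * \<rho> q powr \<alpha> * (r ^ q * exp (- ln r * real N))"
      if \<alpha>: "\<alpha> \<in> D" for \<alpha>
    proof -
      have "ln ((1 + real q) / (1 + real N)) \<le> (1 + real q) / (1 + real N) - 1"
        by (intro ln_le_minus_one) simp
      also have "\<dots> = (real q - real N) / (1 + real N)"
        by (simp add: field_simps)
      finally have "ln (1 + real q) - ln (1 + real N) \<le> (real q - real N) / (1 + real N)"
        by (simp add: ln_div)
      then have "kmax * \<alpha> * (ln (1 + real q) - ln (1 + real N)) \<le> kmax * \<alpha> * ((real q - real N) / (1 + real N))"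
        using \<alpha> \<open>D \<subseteq> {0..}\<close> kmax by (intro mult_left_mono) auto
      also have "\<dots> \<le> (ln r * real N) * ((real q - real N) / (1 + real N))"
        using rr[OF \<alpha>] by (intro mult_right_mono) (auto simp: q_def)
      also have "\<dots> = ln r * (real q - real N) * (real N / (1 + real N))"
        by simp
      also have "\<dots> \<le> ln r * (real q - real N) * 1"
        using r by (intro mult_left_mono) (auto simp: q_def)
      finally have "\<alpha> * ln (\<rho> N) \<le> \<alpha> * ln (\<rho> q) + (ln r * real q - ln r * real N)"
        by (simp add: ln_rho_tau algebra_simps)
      then have "\<rho> N powr \<alpha> \<le> \<rho> q powr \<alpha> * (r ^ q * exp (- ln r * real N))"
        using rho_tau_pos[of N] rho_tau_pos[of q] by (simp add: powr_def rp flip: exp_add)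
      then show ?thesis
        by (simp add: mult.assoc mult_left_mono)
    qed
    then have "(\<Sum>\<alpha>\<in>D. cmod (a q \<alpha>) * \<rho> N powr \<alpha>)
        \<le> (\<Sum>\<alpha>\<in>D. cmod (a q \<alpha>) * \<rho> q powr \<alpha>) * (r ^ q * exp (- ln r * real N))"
      unfolding sum_distrib_right by (rule sum_mono)
    also have "\<dots> \<le> n q * (r ^ q * exp (- ln r * real N))"
      using assms r by (intro mult_right_mono coef) auto
    finally show ?thesis
      by (simp add: T_def q_def mult.assoc)
  qed
  have sc: "summable (\<lambda>p. cmod (a (p + Suc N) \<alpha>) * \<rho> N powr \<alpha>)" for \<alpha>
    by (intro summable_mult2 summable_ignore_initial_segment[OF summable_coef])
  have "(\<Sum>\<alpha>\<in>D. cmod (\<Sum>p\<le>N. a p \<alpha>) * \<rho> N powr \<alpha>)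
      \<le> (\<Sum>\<alpha>\<in>D. (\<Sum>p. cmod (a (p + Suc N) \<alpha>)) * \<rho> N powr \<alpha>)"
    by (intro sum_mono mult_right_mono tail) auto
  also have "\<dots> = (\<Sum>\<alpha>\<in>D. \<Sum>p. cmod (a (p + Suc N) \<alpha>) * \<rho> N powr \<alpha>)"
    by (intro sum.cong refl suminf_mult2 summable_ignore_initial_segment[OF summable_coef])
  also have "\<dots> = (\<Sum>p. \<Sum>\<alpha>\<in>D. cmod (a (p + Suc N) \<alpha>) * \<rho> N powr \<alpha>)"
    by (rule suminf_sum[symmetric]) (rule sc)
  also have "\<dots> \<le> suminf T"
    by (intro suminf_le term_le summable_sum sc summ_T)
  finally show ?thesis
    using suminf_T by simp
qed

text \<open>Each \<open>f p\<close> with p \<le> N is cut at the exponent c * N. The remainders gain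
  exp (- c * N) because the line is 1 to the left of ln (\<rho> N); the finite parts add up to
  coefficients that \<open>coef_partial_sum_le\<close> controls. The imaginary part is unrestricted,
  so any height above pi * kmax / 2 may be chosen.\<close>

lemma exp_small_kmax:
  assumes zero: "\<And>\<alpha>. (\<lambda>p. a p \<alpha>) sums 0"
  shows "exp_small (\<lambda>p z. f p (Fin z)) (ln R) kmax"
proof -
  \<comment> \<open>Satisfies both c \<le> ln r and kmax * c \<le> ln r; the 1 takes care of kmax =
    0.\<close>
  define c where "c = ln r / (1 + kmax)"
  have lnr: "ln r > 0"
    using r by simp
  have c: "c > 0" "c \<le> ln r" "kmax * c \<le> ln r"
    using lnr kmax by (auto simp: c_def divide_simps algebra_simps)
  have "cmod (\<Sum>p\<le>N. f p (Fin z)) \<le> 2 * total_norm * exp (- c * real N)"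
    if z: "Re z = ln R - kmax * ln (1 + real N) - 1" for N z
  proof -
    define \<alpha>1 where "\<alpha>1 = c * real N"
    define D where "D = \<Delta> \<inter> {..<\<alpha>1}"
    have \<alpha>1: "\<alpha>1 \<ge> 0"
      using c by (simp add: \<alpha>1_def)
    have D: "finite D" "D \<subseteq> {0..}"
      using finite_Delta \<Delta> by (auto simp: D_def)
    have zN: "Re z = ln (\<rho> N) - 1"
      using z by (simp add: ln_rho_tau)
    have "cmod (\<Sum>p\<le>N. f p (Fin z) - (\<Sum>\<alpha>\<in>D. a p \<alpha> * exp (of_real \<alpha> * z)))
        \<le> (\<Sum>p\<le>N. n p * exp (- c * real N))"
    proof (rule sum_norm_le)
      fix p assume "p \<in> {..N}"
      then have z': "Re z \<le> ln (\<rho> p) - 1"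
        using zN ln_rho_tau_antimono[of p N] by simp
      then have "cmod (f p (Fin z) - (\<Sum>\<alpha>\<in>D. a p \<alpha> * exp (of_real \<alpha> * z)))
          \<le> n p * exp (\<alpha>1 * (Re z - ln (\<rho> p)))"
        unfolding D_def using \<alpha>1 by (intro expansion_remainder) auto
      also have "\<dots> \<le> n p * exp (- c * real N)"
        using n_nonneg z' \<alpha>1 mult_left_mono[of "Re z - ln (\<rho> p)" "-1" \<alpha>1]
        by (intro mult_left_mono) (auto simp: \<alpha>1_def)
      finally show "cmod (f p (Fin z) - (\<Sum>\<alpha>\<in>D. a p \<alpha> * exp (of_real \<alpha> * z))) \<le> n p * exp (- c * real N)" .
    qed
    also have "\<dots> \<le> (\<Sum>p\<le>N. n p * r ^ p) * exp (- c * real N)"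
      unfolding sum_distrib_right
    proof (intro sum_mono mult_right_mono)
      show "n p \<le> n p * r ^ p" for p
        using mult_left_mono[OF one_le_power[of r p] n_nonneg[of p]] r by simp
    qed simp
    also have "\<dots> \<le> total_norm * exp (- c * real N)"
      unfolding total_norm_def using n_nonneg r by (intro mult_right_mono sum_le_suminf summ) auto
    finally have 1: "cmod (\<Sum>p\<le>N. f p (Fin z) - (\<Sum>\<alpha>\<in>D. a p \<alpha> * exp (of_real \<alpha> * z))) \<le> total_norm * exp (- c * real N)" .
    have "cmod (\<Sum>\<alpha>\<in>D. (\<Sum>p\<le>N. a p \<alpha>) * exp (of_real \<alpha> * z))
        \<le> (\<Sum>\<alpha>\<in>D. cmod (\<Sum>p\<le>N. a p \<alpha>) * \<rho> N powr \<alpha>)"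
    proof (rule sum_norm_le)
      fix \<alpha> assume "\<alpha> \<in> D"
      then have "\<alpha> * Re z \<le> \<alpha> * ln (\<rho> N)"
        using D zN by (intro mult_left_mono) auto
      then show "cmod ((\<Sum>p\<le>N. a p \<alpha>) * exp (of_real \<alpha> * z)) \<le> cmod (\<Sum>p\<le>N. a p \<alpha>) * \<rho> N powr \<alpha>"
        using rho_tau_pos[of N] unfolding norm_mult by (intro mult_left_mono) (auto simp: powr_def)
    qed
    also have "\<dots> \<le> total_norm * exp (- ln r * real N)"
    proof (rule coef_partial_sum_le[OF zero D])
      fix \<alpha> assume "\<alpha> \<in> D"
      then have "kmax * \<alpha> \<le> kmax * (c * real N)"
        using kmax by (intro mult_left_mono) (auto simp: D_def \<alpha>1_def)
      also have "\<dots> \<le> ln r * real N"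
        using mult_right_mono[OF c(3), of "real N"] by (simp add: mult.assoc)
      finally show "kmax * \<alpha> \<le> ln r * real N" .
    qed
    also have "\<dots> \<le> total_norm * exp (- c * real N)"
      using c total_norm_nonneg by (intro mult_left_mono) (auto intro: mult_right_mono)
    finally have 2: "cmod (\<Sum>\<alpha>\<in>D. (\<Sum>p\<le>N. a p \<alpha>) * exp (of_real \<alpha> * z)) \<le> total_norm * exp (- c * real N)" .
    have "(\<Sum>\<alpha>\<in>D. (\<Sum>p\<le>N. a p \<alpha>) * exp (of_real \<alpha> * z)) = (\<Sum>p\<le>N. \<Sum>\<alpha>\<in>D. a p \<alpha> * exp (of_real \<alpha> * z))"
      unfolding sum_distrib_right by (rule sum.swap)
    then have "(\<Sum>p\<le>N. f p (Fin z)) = (\<Sum>p\<le>N. f p (Fin z) - (\<Sum>\<alpha>\<in>D. a p \<alpha> * exp (of_real \<alpha> * z)))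
        + (\<Sum>\<alpha>\<in>D. (\<Sum>p\<le>N. a p \<alpha>) * exp (of_real \<alpha> * z))"
      by (simp add: sum_subtractf)
    then show ?thesis
      using 1 2 norm_triangle_mono by fastforce
  qed
  then show ?thesis
    unfolding exp_small_def using c
    by (intro exI[of _ "pi * kmax / 2 + 1"] exI[of _ 1] exI[of _ c] exI[of _ "2 * total_norm"]) auto
qed

text \<open>Descent on the least level reached: from a positive one, the Watson step reaches the
  next smaller. Level 0 is inserted because the descent must end there even when 0 is not in
  \<open>K\<close>.\<close>

lemma exp_small_0:
  assumes zero: "\<And>\<alpha>. (\<lambda>p. a p \<alpha>) sums 0"
  shows "exp_small (\<lambda>p z. f p (Fin z)) (ln R) 0"
proof -
  define L where "L = {k \<in> insert 0 K. exp_small (\<lambda>p z. f p (Fin z)) (ln R) k}"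
  have L: "finite L" "L \<noteq> {}" "L \<subseteq> {0..}"
    using K kmax(1) exp_small_kmax[OF zero] by (auto simp: L_def)
  define k where "k = Min L"
  have kL: "k \<in> L"
    unfolding k_def using L by (intro Min_in)
  have "k = 0"
  proof (rule ccontr)
    assume "k \<noteq> 0"
    then have k0: "k > 0"
      using kL L by force
    define k' where "k' = Max {\<kappa> \<in> insert 0 K. \<kappa> < k}"
    have "k' \<in> {\<kappa> \<in> insert 0 K. \<kappa> < k}"
      unfolding k'_def using K k0 by (intro Max_in) auto
    then have k': "k' \<in> insert 0 K" "k' < k" "k' \<ge> 0"
      using K by auto
    have gap: "\<kappa> \<le> k' \<or> k \<le> \<kappa>" if "\<kappa> \<in> K" for \<kappa>
    proof (cases "\<kappa> < k")
      case True
      then have "\<kappa> \<le> k'"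
        unfolding k'_def using K that by (intro Max_ge) auto
      then show ?thesis ..
    qed auto
    have mem: "Fin z \<in> S_tau_p K R \<theta> p"
      if "Re z < ln R - k' * ln (1 + real p)" "\<bar>Im z\<bar> < \<theta> * k" for z p
      by (rule mem_S_tau_p_level[OF k'(3) gap that])
    have "exp_small (\<lambda>p z. f p (Fin z)) (ln R) k'"
    proof (rule exp_small_step)
      show "0 \<le> k'" "k' < k"
        using k' by auto
      show "pi * k / 2 < \<theta> * k"
        using mult_strict_right_mono[OF \<theta> k0] by simp
      show "0 < 1 / r" "1 / r < 1"
        using r by auto
      show "cmod (f p (Fin z)) \<le> total_norm * (1 / r) ^ p"
        if "Re z < ln R - k' * ln (1 + real p)" "\<bar>Im z\<bar> < \<theta> * k" for z p
        using bd[OF mem[OF that]] n_le[of p] by linarith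
      show "exp_small (\<lambda>p z. f p (Fin z)) (ln R) k"
        using kL by (simp add: L_def)
      show "(\<lambda>z. f p (Fin z)) holomorphic_on {z. Re z < ln R - k' * ln (1 + real p) \<and> \<bar>Im z\<bar> < \<theta> * k}" for p
      proof (rule hol)
        show "open {z. Re z < ln R - k' * ln (1 + real p) \<and> \<bar>Im z\<bar> < \<theta> * k}"
          by (intro open_Collect_conj open_Collect_less continuous_intros)
      qed (use mem in auto)
    qed
    then have "k' \<in> L"
      using k' by (simp add: L_def)
    then have "k \<le> k'"
      unfolding k_def using L by (intro Min_le)
    then show False
      using k' by simp
  qed
  then show ?thesis
    using kL by (simp add: L_def)
qed

lemma sum_eq_zero:
  assumes zero: "\<And>\<alpha>. (\<lambda>p. a p \<alpha>) sums 0"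
    and F: "\<And>w. w \<in> S_tau K R \<theta> \<Longrightarrow> (\<lambda>p. f p w) sums F w"
    and holF: "(\<lambda>z. F (Fin z)) holomorphic_on Fin -` S_tau K R \<theta>"
    and w: "w \<in> S_tau K R \<theta>"
  shows "F w = 0"
proof (cases w)
  case MInf
  \<comment> \<open>The identity theorem does not cover \<open>MInf\<close>; there every log-sum
    reduces to its constant coefficient.\<close>
  have "f p MInf = a p 0" for p
  proof -
    have "f p MInf = infsum (\<lambda>\<alpha>. a p \<alpha> * log_monomial \<alpha> MInf) {0..}"
      using ser[of MInf p] by (simp add: half_plane_def log_sum_def)
    also have "\<dots> = infsum (\<lambda>\<alpha>. a p \<alpha> * log_monomial \<alpha> MInf) {0}"
      by (rule infsum_cong_neutral) auto
    finally show ?thesis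
      by simp
  qed
  then have "(\<lambda>p. f p w) sums 0"
    using zero[of 0] MInf by simp
  then show ?thesis
    using F[OF w] sums_unique2 by blast
next
  case (Fin z)
  obtain A \<delta> \<eta> C where A: "A > 0" "\<delta> > 0" "\<eta> > 0" and small: "\<And>N w. Re w = ln R - \<delta> \<Longrightarrow> \<bar>Im w\<bar> < A \<Longrightarrow>
        cmod (\<Sum>p\<le>N. f p (Fin w)) \<le> C * exp (- \<eta> * real N)"
    using exp_small_0[OF zero] unfolding exp_small_def by auto
  define V where "V = Fin -` S_tau K R \<theta>"
  define U where "U = {w \<in> V. Re w = ln R - \<delta> \<and> \<bar>Im w\<bar> < A}"
  define \<xi> where "\<xi> = complex_of_real (ln R - \<delta>)"
  have \<xi>: "\<xi> \<in> V"
    using vimage_S_tau(3)[of "ln R - \<delta>"] A by (simp add: \<xi>_def V_def)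
  have V: "open V" "convex V"
    using vimage_S_tau by (auto simp: V_def)
  have "F (Fin z) = 0"
  proof (rule analytic_continuation[of "\<lambda>z. F (Fin z)" V U \<xi>])
    show "(\<lambda>z. F (Fin z)) holomorphic_on V"
      using holF by (simp add: V_def)
    show "F (Fin u) = 0" if "u \<in> U" for u
    proof -
      have "(\<lambda>N. \<Sum>p\<le>N. f p (Fin u)) \<longlonglongrightarrow> F (Fin u)"
        using F[of "Fin u"] that by (simp add: sums_def_le U_def V_def)
      moreover have "(\<lambda>N. \<Sum>p\<le>N. f p (Fin u)) \<longlonglongrightarrow> 0"
      proof (rule Lim_null_comparison)
        show "\<forall>\<^sub>F N in sequentially. cmod (\<Sum>p\<le>N. f p (Fin u)) \<le> C * exp (- \<eta> * real N)"
          using that by (intro always_eventually allI small) (auto simp: U_def)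
        show "(\<lambda>N. C * exp (- \<eta> * real N)) \<longlonglongrightarrow> 0"
          using A(3) by real_asymp
      qed
      ultimately show ?thesis
        by (rule LIMSEQ_unique)
    qed
    show "\<xi> islimpt U"
      unfolding islimpt_approachable
    proof (intro allI impI)
      fix e :: real assume "e > 0"
      obtain d where d: "d > 0" "ball \<xi> d \<subseteq> V"
        using V \<xi> by (meson open_contains_ball)
      define t where "t = min (min e d) A / 2"
      have t: "0 < t" "t < e" "t < d" "t < A"
        using \<open>e > 0\<close> d A by (auto simp: t_def)
      have dist: "dist (\<xi> + \<i> * of_real t) \<xi> = t"
        using t by (simp add: dist_norm norm_mult)
      then have "\<xi> + \<i> * of_real t \<in> ball \<xi> d"
        using t by (simp add: dist_commute)
      then have "\<xi> + \<i> * of_real t \<in> U"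
        using d t by (auto simp: U_def \<xi>_def)
      then show "\<exists>x'\<in>U. x' \<noteq> \<xi> \<and> dist x' \<xi> < e"
        using dist t by (intro bexI[of _ "\<xi> + \<i> * of_real t"]) auto
    qed
    show "connected V"
      using V by (simp add: convex_connected)
  qed (use V \<xi> w Fin in \<open>auto simp: U_def V_def\<close>)
  then show ?thesis
    using Fin by simp
qed

end

section \<open>The map T\<close>

text \<open>Reduces both uniqueness of the expansion and injectivity to statements about a single
  family with sum 0 or with coefficients summing to 0.\<close>

lemma multisum_data_diff:
  assumes "multisum_data K \<Delta> R r \<theta> f a n" "multisum_data K \<Delta> R r \<theta> f' a' n'"
  shows "multisum_data K \<Delta> R r \<theta> (\<lambda>p w. f p w - f' p w) (\<lambda>p \<alpha>. a p \<alpha> - a' p \<alpha>) (\<lambda>p. n p + n' p)"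
proof -
  interpret A: multisum_data K \<Delta> R r \<theta> f a n by fact
  interpret B: multisum_data K \<Delta> R r \<theta> f' a' n' by fact
  show ?thesis
  proof
    show "(\<lambda>z. f p (Fin z) - f' p (Fin z)) holomorphic_on V"
      if "open V" "Fin ` V \<subseteq> S_tau_p K R \<theta> p" for V p
      by (intro holomorphic_on_diff A.hol B.hol that)
    show "cmod (f p w - f' p w) \<le> n p + n' p" if "w \<in> S_tau_p K R \<theta> p" for w p
      using norm_triangle_le_diff[OF add_mono[OF A.bd[OF that] B.bd[OF that]]] by simp
    show "\<alpha> \<in> \<Delta>" if "a p \<alpha> - a' p \<alpha> \<noteq> 0" for p \<alpha>
      using A.supp[of p \<alpha>] B.supp[of p \<alpha>] that by fastforce
    show "(\<Sum>\<alpha>\<in>S. cmod (a p \<alpha> - a' p \<alpha>) * rho_tau K R p powr \<alpha>) \<le> n p + n' p"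
      if "finite S" "S \<subseteq> {0..}" for S p
    proof -
      have "(\<Sum>\<alpha>\<in>S. cmod (a p \<alpha> - a' p \<alpha>) * rho_tau K R p powr \<alpha>)
          \<le> (\<Sum>\<alpha>\<in>S. cmod (a p \<alpha>) * rho_tau K R p powr \<alpha> + cmod (a' p \<alpha>) * rho_tau K R p powr \<alpha>)"
        unfolding distrib_right[symmetric] by (intro sum_mono mult_right_mono norm_triangle_ineq4) auto
      also have "\<dots> \<le> n p + n' p"
        unfolding sum.distrib by (intro add_mono A.coef B.coef that)
      finally show ?thesis .
    qed
    show "f p w - f' p w = log_sum (\<lambda>\<alpha>. a p \<alpha> - a' p \<alpha>) w"
      if w: "w \<in> half_plane (ln (rho_tau K R p))" for w p
    proof -
      have "((\<lambda>\<alpha>. a p \<alpha> * log_monomial \<alpha> w - a' p \<alpha> * log_monomial \<alpha> w) has_sum (f p w - f' p w)) {0..}"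
        unfolding A.ser[OF w] B.ser[OF w] log_sum_def diff_conv_add_uminus
        by (intro has_sum_add has_sum_uminusI has_sum_infsum A.log_sum_summable B.log_sum_summable w)
      then show ?thesis
        by (simp add: log_sum_def left_diff_distrib infsumI)
    qed
    show "summable (\<lambda>p. (n p + n' p) * r ^ p)"
      unfolding distrib_right by (intro summable_add A.summ B.summ)
  qed
qed

context multisum_setting
begin

text \<open>The norm of \<open>Fs p\<close> and the supremum of \<open>fs p\<close> are added to
  give one \<open>n p\<close> that serves both bounds.\<close>

lemma multisum_data_of_repr:
  assumes "multisum_repr K R r \<theta> \<Delta> f fs Fs"
  obtains n where "multisum_data K \<Delta> R r \<theta> fs Fs n"
proof -
  note repr = assms[unfolded multisum_repr_def]
  define G where "G p = gps_norm (\<rho> p) (Fs p)" for p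
  define H where "H p = (SUP w\<in>S_tau_p K R \<theta> p. ennreal (cmod (fs p w)))" for p
  have r0: "r > 0"
    using r by simp
  have "(\<Sum>p. G p * ennreal (r ^ p)) < \<infinity>" "(\<Sum>p. H p * ennreal (r ^ p)) < \<infinity>"
    using repr by (auto simp: G_def H_def)
  note GH = summable_of_ennreal_suminf_weighted[OF this(1) r0] summable_of_ennreal_suminf_weighted[OF this(2) r0]
  have "multisum_data K \<Delta> R r \<theta> fs Fs (\<lambda>p. enn2real (G p) + enn2real (H p))"
  proof
    show "(\<lambda>z. fs p (Fin z)) holomorphic_on V" if V: "open V" "Fin ` V \<subseteq> S_tau_p K R \<theta> p" for V p
    proof -
      obtain D g where D: "S_tau_p K R \<theta> p \<subseteq> D" "log_holomorphic_on g D" "\<forall>w\<in>S_tau_p K R \<theta> p. fs p w = g w"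
        using repr by blast
      have "V \<subseteq> Fin -` D"
        using D(1) V(2) by blast
      then have "(\<lambda>z. g (Fin z)) holomorphic_on V"
        using D unfolding log_holomorphic_on_def by (auto intro: holomorphic_on_subset)
      then show ?thesis
        by (rule holomorphic_transform) (use D V in auto)
    qed
    show "cmod (fs p w) \<le> enn2real (G p) + enn2real (H p)" if "w \<in> S_tau_p K R \<theta> p" for w p
    proof -
      have "ennreal (cmod (fs p w)) \<le> H p"
        unfolding H_def using that by (rule SUP_upper)
      also have "\<dots> = ennreal (enn2real (H p))"
        using GH(3)[of p] by simp
      finally have "cmod (fs p w) \<le> enn2real (H p)"
        by simp
      then show ?thesis
        by (simp add: add_increasing)
    qed
    show "\<alpha> \<in> \<Delta>" if "Fs p \<alpha> \<noteq> 0" for p \<alpha>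
      using repr that by (auto simp: gps_support_def)
    show "(\<Sum>\<alpha>\<in>S. cmod (Fs p \<alpha>) * \<rho> p powr \<alpha>) \<le> enn2real (G p) + enn2real (H p)"
      if S: "finite S" "S \<subseteq> {0..}" for S p
    proof -
      have "ennreal (\<Sum>\<alpha>\<in>S. cmod (Fs p \<alpha>) * \<rho> p powr \<alpha>) = (\<Sum>\<alpha>\<in>S. ennreal (cmod (Fs p \<alpha>) * \<rho> p powr \<alpha>))"
        by (rule sum_ennreal[symmetric]) simp
      also have "\<dots> \<le> G p"
        unfolding G_def gps_norm_def using S
        by (subst nonneg_infsum_complete) (auto intro!: SUP_upper)
      also have "\<dots> = ennreal (enn2real (G p))"
        using GH(1)[of p] by simp
      finally have "(\<Sum>\<alpha>\<in>S. cmod (Fs p \<alpha>) * \<rho> p powr \<alpha>) \<le> enn2real (G p)"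
        by simp
      then show ?thesis
        by (simp add: add_increasing2)
    qed
    show "fs p w = log_sum (Fs p) w" if "w \<in> half_plane (ln (\<rho> p))" for w p
      using repr that by blast
    show "summable (\<lambda>p. (enn2real (G p) + enn2real (H p)) * r ^ p)"
      unfolding distrib_right using GH(2,4) by (rule summable_add)
  qed
  then show ?thesis
    by (rule that)
qed

section \<open>Independence of the representation\<close>

lemma repr_coef_summable:
  assumes "multisum_repr K R r \<theta> \<Delta> f fs Fs"
  shows "summable (\<lambda>p. Fs p \<alpha>)"
proof -
  obtain n where "multisum_data K \<Delta> R r \<theta> fs Fs n"
    using multisum_data_of_repr[OF assms] .
  then interpret multisum_data K \<Delta> R r \<theta> fs Fs n .
  show ?thesis
    by (rule summable_norm_cancel[OF summable_coef])
qed

lemma repr_coef_unique: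
  assumes F: "multisum_repr K R r \<theta> \<Delta> f fs Fs" and G: "multisum_repr K R r \<theta> \<Delta> f gs Gs"
  shows "(\<Sum>p. Fs p \<alpha>) = (\<Sum>p. Gs p \<alpha>)"
proof -
  obtain n m where "multisum_data K \<Delta> R r \<theta> fs Fs n" "multisum_data K \<Delta> R r \<theta> gs Gs m"
    using multisum_data_of_repr[OF F] multisum_data_of_repr[OF G] by metis
  then interpret multisum_data K \<Delta> R r \<theta> "\<lambda>p w. fs p w - gs p w" "\<lambda>p \<alpha>. Fs p \<alpha> - Gs p \<alpha>" "\<lambda>p. n p + m p"
    by (rule multisum_data_diff)
  have "(\<lambda>p. fs p w - gs p w) sums 0" if "w \<in> S_tau K R \<theta>" for w
    using sums_diff[of "\<lambda>p. fs p w" "f w" "\<lambda>p. gs p w" "f w"] F G that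
    by (simp add: multisum_repr_def)
  then have "(\<lambda>p. Fs p \<alpha> - Gs p \<alpha>) sums 0"
    by (rule coef_sums_zero)
  then have "(\<Sum>p. Fs p \<alpha> - Gs p \<alpha>) = 0"
    by (rule sums_unique[symmetric])
  then show ?thesis
    using suminf_diff[OF repr_coef_summable[OF F] repr_coef_summable[OF G], of \<alpha> \<alpha>] by simp
qed

text \<open>Justifies the definite description in \<open>T_map\<close>: existence is the given
  representation, uniqueness is \<open>repr_coef_unique\<close>.\<close>

lemma T_map_eq:
  assumes "multisum_repr K R r \<theta> \<Delta> f fs Fs"
  shows "T_map K R r \<theta> \<Delta> f = (\<lambda>\<alpha>. \<Sum>p. Fs p \<alpha>)"
  unfolding T_map_def
proof (rule the_equality)
  show "\<exists>fs' Fs'. multisum_repr K R r \<theta> \<Delta> f fs' Fs' \<and> (\<lambda>\<alpha>. \<Sum>p. Fs p \<alpha>) = (\<lambda>\<alpha>. \<Sum>p. Fs' p \<alpha>)"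
    using assms by blast
qed (use repr_coef_unique[OF assms] in auto)

lemma T_map_in_gen_power_series:
  assumes "f \<in> multisummable K R r \<theta> \<Delta>"
  shows "T_map K R r \<theta> \<Delta> f \<in> gen_power_series"
proof -
  obtain fs Fs where repr: "multisum_repr K R r \<theta> \<Delta> f fs Fs"
    using assms by (auto simp: multisummable_def)
  have "\<alpha> \<in> \<Delta>" if "(\<Sum>p. Fs p \<alpha>) \<noteq> 0" for \<alpha>
  proof (rule ccontr)
    assume "\<alpha> \<notin> \<Delta>"
    then have "Fs p \<alpha> = 0" for p
      using repr by (auto simp: multisum_repr_def gps_support_def)
    then show False
      using that by simp
  qed
  then have supp: "gps_support (T_map K R r \<theta> \<Delta> f) \<subseteq> \<Delta>"
    by (auto simp: T_map_eq[OF repr] gps_support_def)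
  have "\<exists>x\<in>A. \<forall>y\<in>A. x \<le> y" if A: "A \<subseteq> \<Delta>" "A \<noteq> {}" for A
  proof -
    obtain x where x: "x \<in> A"
      using A by auto
    \<comment> \<open>A ray ending just past \<open>x\<close> cuts out a finite nonempty set because
      \<Delta> is natural; its minimum is least in all of \<open>A\<close>.\<close>
    define B where "B = A \<inter> {..<x + 1}"
    have B: "finite B" "B \<noteq> {}"
      using finite_subset[OF _ finite_Delta[of "x + 1"], of B] A x by (auto simp: B_def)
    have "Min B \<in> A"
      using Min_in[OF B] by (auto simp: B_def)
    moreover have "Min B \<le> y" if "y \<in> A" for y
    proof (cases "y < x + 1")
      case True
      then show ?thesis
        using that B by (auto simp: B_def)
    next
      case False
      then show ?thesis
        using Min_le[OF B(1), of x] x by (auto simp: B_def)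
    qed
    ultimately show ?thesis
      by blast
  qed
  then have "\<forall>A\<subseteq>gps_support (T_map K R r \<theta> \<Delta> f). A \<noteq> {} \<longrightarrow> (\<exists>x\<in>A. \<forall>y\<in>A. x \<le> y)"
    using supp by (meson subset_trans)
  moreover have "gps_support (T_map K R r \<theta> \<Delta> f) \<subseteq> {0..}"
    using supp \<Delta>(1) by (rule order_trans)
  ultimately show ?thesis
    unfolding gen_power_series_def by simp
qed

lemma T_map_inj_on: "inj_on (T_map K R r \<theta> \<Delta>) (multisummable K R r \<theta> \<Delta>)"
proof (rule inj_onI)
  fix f g assume f: "f \<in> multisummable K R r \<theta> \<Delta>" and g: "g \<in> multisummable K R r \<theta> \<Delta>"
    and eq: "T_map K R r \<theta> \<Delta> f = T_map K R r \<theta> \<Delta> g"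
  obtain fs Fs gs Gs where F: "multisum_repr K R r \<theta> \<Delta> f fs Fs" and G: "multisum_repr K R r \<theta> \<Delta> g gs Gs"
    using f g by (auto simp: multisummable_def)
  obtain n m where "multisum_data K \<Delta> R r \<theta> fs Fs n" "multisum_data K \<Delta> R r \<theta> gs Gs m"
    using multisum_data_of_repr[OF F] multisum_data_of_repr[OF G] by metis
  then interpret multisum_data K \<Delta> R r \<theta> "\<lambda>p w. fs p w - gs p w" "\<lambda>p \<alpha>. Fs p \<alpha> - Gs p \<alpha>" "\<lambda>p. n p + m p"
    by (rule multisum_data_diff)
  have coef0: "(\<lambda>p. Fs p \<alpha> - Gs p \<alpha>) sums 0" for \<alpha>
  proof -
    have "(\<lambda>p. Fs p \<alpha> - Gs p \<alpha>) sums ((\<Sum>p. Fs p \<alpha>) - (\<Sum>p. Gs p \<alpha>))"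
      by (intro sums_diff summable_sums repr_coef_summable[OF F] repr_coef_summable[OF G])
    moreover have "(\<Sum>p. Fs p \<alpha>) = (\<Sum>p. Gs p \<alpha>)"
      using fun_cong[OF eq, of \<alpha>] by (simp add: T_map_eq[OF F] T_map_eq[OF G])
    ultimately show ?thesis
      by simp
  qed
  have "f w - g w = 0" if "w \<in> S_tau K R \<theta>" for w
  proof (rule sum_eq_zero[OF coef0])
    show "(\<lambda>p. fs p v - gs p v) sums (f v - g v)" if "v \<in> S_tau K R \<theta>" for v
      using F G that by (intro sums_diff) (auto simp: multisum_repr_def)
    show "(\<lambda>z. f (Fin z) - g (Fin z)) holomorphic_on Fin -` S_tau K R \<theta>"
      using f g by (intro holomorphic_on_diff) (auto simp: multisummable_def log_holomorphic_on_def)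
  qed (rule that)
  moreover have "f \<in> extensional (S_tau K R \<theta>)" "g \<in> extensional (S_tau K R \<theta>)"
    using f g by (auto simp: multisummable_def)
  ultimately show "f = g"
    by (auto intro: extensionalityI)
qed

end

theorem theorem1p28:
  fixes K \<Delta> :: "real set" and R r \<theta> :: real
  assumes "K \<subseteq> {0..}" and "K \<noteq> {}" and "finite K"
    and "R > 0" and "r > 1" and "\<theta> > pi / 2"
    and "\<Delta> \<subseteq> {0..}" and "natural_set \<Delta>" and "\<forall>\<alpha>\<in>\<Delta>. \<forall>\<beta>\<in>\<Delta>. \<alpha> + \<beta> \<in> \<Delta>"
  shows "T_map K R r \<theta> \<Delta> \<in> multisummable K R r \<theta> \<Delta> \<rightarrow> gen_power_series \<and>
         inj_on (T_map K R r \<theta> \<Delta>) (multisummable K R r \<theta> \<Delta>)"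
proof -
  interpret multisum_setting K \<Delta> R r \<theta>
    using assms by unfold_locales
  show ?thesis
    using T_map_in_gen_power_series T_map_inj_on by blast
qed

end
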